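(* Let $H$ be a Hilbert space and let $X$ be a unital operator space with $X\subseteq C=C^*(X)\subseteq\mathcal B(H)$. Then the Šilov ideal of $X$ in $C$ is the biggest boundary subsystem for $X$ contained in $C$; i.e. it is a boundary subsystem for $X$ in $C$ and it contains every boundary subsystem for $X$ in $C$.
   Context: $X$ is a linear subspace of $\mathcal B(H)$ containing $I_H$, with the inherited matrix norms on $M_\nu(X)\subseteq M_\nu(\mathcal B(H))=\mathcal B(H^\nu)$; $C^*(X)$ is the $C^*$-algebra generated by $X$ in $\mathcal B(H)$. A linear map $\phi$ is completely isometric if all its amplifications $\phi_\nu([a_{ij}])=[\phi(a_{ij})]$, $\nu\in\mathbb N$, are isometric. A boundary subsystem for $X$ in $C$ is a selfadjoint linear subspace $V\subseteq C$ (not required to contain the unit) such that the restriction to $X$ of the quotient map $q_V\colon C\to C/V$ is completely isometric, where $C/V$ has matrix norms $\|[a_{ij}+V]\|_\nu=\inf\{\|[a_{ij}+y_{ij}]\|_\nu : y_{ij}\in V\}$. A (closed two-sided) ideal $J$ of $C$ is boundary for $X$ if the quotient map $C\to C/J$ is completely isometric on $X$; the Šilov ideal of $X$ in $C$ is the biggest boundary ideal, i.e. the boundary ideal containing every boundary ideal (it always exists). *)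

theory Defs
  imports "HOL-Analysis.Analysis"
begin

section \<open>Complex Hilbert spaces\<close>

class complex_vector = real_vector +
  fixes scaleC :: "complex \<Rightarrow> 'a \<Rightarrow> 'a" (infixr "*\<^sub>C" 75)
  assumes scaleC_add_right: "c *\<^sub>C (x + y) = c *\<^sub>C x + c *\<^sub>C y"
    and scaleC_add_left: "(c + d) *\<^sub>C x = c *\<^sub>C x + d *\<^sub>C x"
    and scaleC_scaleC: "c *\<^sub>C d *\<^sub>C x = (c * d) *\<^sub>C x"
    and scaleC_of_real: "complex_of_real r *\<^sub>C x = r *\<^sub>R x"

definition csubspace :: "'a::complex_vector set \<Rightarrow> bool" where
  "csubspace V \<longleftrightarrow> 0 \<in> V \<and> (\<forall>x\<in>V. \<forall>y\<in>V. x + y \<in> V) \<and> (\<forall>c. \<forall>x\<in>V. c *\<^sub>C x \<in> V)"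

text \<open>The complex inner product is linear in its first argument. The real inner product of the
  underlying real space is its real part, so that the norm is the usual one,
  \<open>norm x = sqrt (Re (cinner x x))\<close>; positive definiteness is inherited from \<open>real_inner\<close>.\<close>

class complex_inner = complex_vector + real_inner +
  fixes cinner :: "'a \<Rightarrow> 'a \<Rightarrow> complex"
  assumes cinner_commute: "cinner x y = cnj (cinner y x)"
    and cinner_add_left: "cinner (x + y) z = cinner x z + cinner y z"
    and cinner_scaleC_left: "cinner (c *\<^sub>C x) y = c * cinner x y"
    and inner_eq_Re_cinner: "inner x y = Re (cinner x y)"

class chilbert_space = complex_inner + complete_space

lemma cinner_scaleC_right: "cinner x (c *\<^sub>C y) = cnj c * cinner x y"
  by (metis cinner_commute cinner_scaleC_left complex_cnj_mult)

lemma norm_scaleC: "norm (c *\<^sub>C x) = cmod c * norm (x::'a::complex_inner)"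
proof -
  have "cinner (c *\<^sub>C x) (c *\<^sub>C x) = complex_of_real ((cmod c)\<^sup>2) * cinner x x"
    by (simp only: cinner_scaleC_left cinner_scaleC_right complex_norm_square mult_ac)
  then have "inner (c *\<^sub>C x) (c *\<^sub>C x) = (cmod c)\<^sup>2 * inner x x"
    by (simp only: inner_eq_Re_cinner) simp
  then show ?thesis
    by (simp add: norm_eq_sqrt_inner real_sqrt_mult)
qed

lemma scaleC_scaleR: "c *\<^sub>C r *\<^sub>R x = r *\<^sub>R c *\<^sub>C (x::'a::complex_vector)"
  by (simp flip: scaleC_of_real add: scaleC_scaleC mult.commute)

lemma bounded_linear_scaleC: "bounded_linear (\<lambda>x::'a::complex_inner. c *\<^sub>C x)"
  by (rule bounded_linear_intro[where K = "cmod c"])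
    (simp_all add: scaleC_add_right scaleC_scaleR norm_scaleC mult.commute)

section \<open>Bounded operators\<close>

instantiation blinfun :: (real_normed_vector, complex_inner) complex_vector
begin

lift_definition scaleC_blinfun :: "complex \<Rightarrow> ('a \<Rightarrow>\<^sub>L 'b) \<Rightarrow> ('a \<Rightarrow>\<^sub>L 'b)"
  is "\<lambda>c f x. c *\<^sub>C f x"
  by (rule bounded_linear_compose[OF bounded_linear_scaleC])

instance
  by standard
    (transfer; simp add: fun_eq_iff scaleC_add_right scaleC_add_left scaleC_scaleC scaleC_of_real)+

end

text \<open>The type \<open>'h \<Rightarrow>\<^sub>L 'h\<close> consists of the bounded real-linear operators; the algebra of bounded
  operators on the complex Hilbert space is the following subset, with the inherited operations
  and (operator) norm.\<close>

definition bounded_ops :: "('h::chilbert_space \<Rightarrow>\<^sub>L 'h) set" where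
  "bounded_ops = {A. \<forall>c x. blinfun_apply A (c *\<^sub>C x) = c *\<^sub>C blinfun_apply A x}"

definition hadjoint :: "('h::chilbert_space \<Rightarrow>\<^sub>L 'h) \<Rightarrow> ('h \<Rightarrow>\<^sub>L 'h)" where
  "hadjoint A = (THE B. \<forall>x y. cinner (blinfun_apply A x) y = cinner x (blinfun_apply B y))"

lemma hadjoint_eqI:
  assumes "\<And>x y. cinner (blinfun_apply A x) y = cinner x (blinfun_apply B y)"
  shows "hadjoint A = B"
  unfolding hadjoint_def
proof (rule the_equality)
  fix B' assume B': "\<forall>x y. cinner (blinfun_apply A x) y = cinner x (blinfun_apply B' y)"
  have "blinfun_apply B' y = blinfun_apply B y" for y
    by (rule vector_eq_rdot[THEN iffD1]) (metis B' assms inner_commute inner_eq_Re_cinner)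
  then show "B' = B" by (rule blinfun_eqI)
qed (simp add: assms)

definition selfadjoint_set :: "('h::chilbert_space \<Rightarrow>\<^sub>L 'h) set \<Rightarrow> bool" where
  "selfadjoint_set V \<longleftrightarrow> (\<forall>A\<in>V. hadjoint A \<in> V)"

definition cstar_subalgebra :: "('h::chilbert_space \<Rightarrow>\<^sub>L 'h) set \<Rightarrow> bool" where
  "cstar_subalgebra A \<longleftrightarrow> A \<subseteq> bounded_ops \<and> csubspace A \<and> selfadjoint_set A \<and> closed A \<and>
     (\<forall>S\<in>A. \<forall>T\<in>A. S o\<^sub>L T \<in> A)"

definition cstar_generated :: "('h::chilbert_space \<Rightarrow>\<^sub>L 'h) set \<Rightarrow> ('h \<Rightarrow>\<^sub>L 'h) set" where
  "cstar_generated X = \<Inter>{A. cstar_subalgebra A \<and> X \<subseteq> A}"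

definition unital_operator_space :: "('h::chilbert_space \<Rightarrow>\<^sub>L 'h) set \<Rightarrow> bool" where
  "unital_operator_space X \<longleftrightarrow> X \<subseteq> bounded_ops \<and> csubspace X \<and> id_blinfun \<in> X"

definition closed_ideal :: "('h::chilbert_space \<Rightarrow>\<^sub>L 'h) set \<Rightarrow> ('h \<Rightarrow>\<^sub>L 'h) set \<Rightarrow> bool" where
  "closed_ideal C J \<longleftrightarrow> J \<subseteq> C \<and> csubspace J \<and> closed J \<and>
     (\<forall>S\<in>C. \<forall>T\<in>J. S o\<^sub>L T \<in> J \<and> T o\<^sub>L S \<in> J)"

section \<open>Matrix norms and completely isometric maps\<close>

text \<open>A \<open>\<nu> \<times> \<nu>\<close> matrix is a function of two indices of which only the values at indices below \<open>\<nu>\<close>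
  matter. Likewise a vector of \<open>H\<^sup>\<nu>\<close> is a function \<open>\<xi>\<close>, and the matrix norm is the operator norm
  on the Hilbert space \<open>H\<^sup>\<nu>\<close>.\<close>

definition mat_norm :: "nat \<Rightarrow> (nat \<Rightarrow> nat \<Rightarrow> ('h::chilbert_space \<Rightarrow>\<^sub>L 'h)) \<Rightarrow> real" where
  "mat_norm \<nu> a =
     (SUP \<xi>\<in>{\<xi>. (\<Sum>j<\<nu>. (norm (\<xi> j))\<^sup>2) \<le> 1}.
        sqrt (\<Sum>i<\<nu>. (norm (\<Sum>j<\<nu>. blinfun_apply (a i j) (\<xi> j)))\<^sup>2))"

text \<open>The quotient by \<open>V\<close> is represented by cosets. The norm of a matrix of cosets \<open>K i j\<close> is the
  infimum over all matrices of representatives; for \<open>K i j = a i j + V\<close> these are exactly the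
  matrices \<open>a i j + y i j\<close> with \<open>y i j \<in> V\<close>.\<close>

definition quot_map :: "('h::chilbert_space \<Rightarrow>\<^sub>L 'h) set \<Rightarrow> ('h \<Rightarrow>\<^sub>L 'h) \<Rightarrow> ('h \<Rightarrow>\<^sub>L 'h) set" where
  "quot_map V a = {a + y |y. y \<in> V}"

definition quot_mat_norm :: "nat \<Rightarrow> (nat \<Rightarrow> nat \<Rightarrow> ('h::chilbert_space \<Rightarrow>\<^sub>L 'h) set) \<Rightarrow> real" where
  "quot_mat_norm \<nu> K = (INF b\<in>{b. \<forall>i<\<nu>. \<forall>j<\<nu>. b i j \<in> K i j}. mat_norm \<nu> b)"

text \<open>\<open>N\<close> and \<open>M\<close> are the matrix norms on the domain and on the codomain; isometry is stated as
  preservation of norms, which is the correct notion for linear \<open>\<phi>\<close>.\<close>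

definition completely_isometric_on ::
  "'a set \<Rightarrow> (nat \<Rightarrow> (nat \<Rightarrow> nat \<Rightarrow> 'a) \<Rightarrow> real) \<Rightarrow> (nat \<Rightarrow> (nat \<Rightarrow> nat \<Rightarrow> 'b) \<Rightarrow> real) \<Rightarrow>
     ('a \<Rightarrow> 'b) \<Rightarrow> bool" where
  "completely_isometric_on X N M \<phi> \<longleftrightarrow>
     (\<forall>\<nu> a. (\<forall>i<\<nu>. \<forall>j<\<nu>. a i j \<in> X) \<longrightarrow> M \<nu> (\<lambda>i j. \<phi> (a i j)) = N \<nu> a)"

section \<open>Boundary subsystems and the Silov ideal\<close>

definition boundary_subsystem ::
  "('h::chilbert_space \<Rightarrow>\<^sub>L 'h) set \<Rightarrow> ('h \<Rightarrow>\<^sub>L 'h) set \<Rightarrow> ('h \<Rightarrow>\<^sub>L 'h) set \<Rightarrow> bool" where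
  "boundary_subsystem X C V \<longleftrightarrow> V \<subseteq> C \<and> csubspace V \<and> selfadjoint_set V \<and>
     completely_isometric_on X mat_norm quot_mat_norm (quot_map V)"

definition boundary_ideal ::
  "('h::chilbert_space \<Rightarrow>\<^sub>L 'h) set \<Rightarrow> ('h \<Rightarrow>\<^sub>L 'h) set \<Rightarrow> ('h \<Rightarrow>\<^sub>L 'h) set \<Rightarrow> bool" where
  "boundary_ideal X C J \<longleftrightarrow> closed_ideal C J \<and>
     completely_isometric_on X mat_norm quot_mat_norm (quot_map J)"

definition silov_ideal ::
  "('h::chilbert_space \<Rightarrow>\<^sub>L 'h) set \<Rightarrow> ('h \<Rightarrow>\<^sub>L 'h) set \<Rightarrow> ('h \<Rightarrow>\<^sub>L 'h) set" where
  "silov_ideal X C = (THE J. boundary_ideal X C J \<and> (\<forall>K. boundary_ideal X C K \<longrightarrow> K \<subseteq> J))"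

lemma silov_ideal_eqI:
  assumes "boundary_ideal X C J" "\<And>K. boundary_ideal X C K \<Longrightarrow> K \<subseteq> J"
  shows "silov_ideal X C = J"
  unfolding silov_ideal_def using assms by (intro the_equality) blast+

end

theory Submission
  imports Defs "HOL-Library.Function_Algebras"
begin

text \<open>Consider the linear complete contractions of the operators on \<open>H\<close> into themselves that fix \<open>X\<close>
  pointwise (\<open>fixing X\<close>). Among them there is a minimal one, \<open>\<phi>\<close>, with \<open>\<phi> \<circ> \<phi> = \<phi>\<close> and
  \<open>\<phi> \<circ> \<psi> \<circ> \<phi> = \<phi>\<close> for every other such map \<open>\<psi>\<close> (\<open>minimal_fixing\<close>); its range is a copy of Hamana's
  injective envelope of \<open>X\<close>. The Silov ideal is the kernel of \<open>\<phi>\<close> on \<open>C\<close>. This rests on two facts.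

  First, \<open>\<phi> \<circ> \<psi> = \<phi>\<close> on \<open>C\<close> for all \<open>\<psi>\<close>, and \<open>\<phi> (c b) = \<phi> (c \<phi> b)\<close> for \<open>c\<close> in \<open>C\<close>. Indeed, for \<open>x\<close> in \<open>X\<close>
  the Kadison--Schwarz inequality gives \<open>\<psi> (x\<^sup>* x) \<ge> x\<^sup>* x\<close> and \<open>\<phi> (x\<^sup>* x) \<ge> x\<^sup>* x\<close>. Applying \<open>\<phi>\<close> to the first
  inequality and \<open>\<phi> \<circ> \<psi>\<close> to the second yields \<open>\<phi> (\<psi> (x\<^sup>* x)) = \<phi> (x\<^sup>* x)\<close>: equality holds in the
  Schwarz inequality for \<open>x\<close>, and likewise for \<open>x\<^sup>*\<close>. As for any multiplicative domain, this forces
  \<open>\<phi> (\<psi> (x b)) = \<phi> (x \<psi> b)\<close> for all \<open>b\<close>, and the operators with this property form a closed algebra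
  (\<open>cstar_generated_mult_domain\<close>). Hence the kernel is an ideal, and it is boundary because \<open>\<phi>\<close> is a
  complete contraction that fixes \<open>X\<close>.

  Second, if \<open>V\<close> is a subspace such that \<open>X\<close> embeds completely isometrically into the quotient by
  \<open>V\<close>, then the inverse of this embedding extends to a complete contraction \<open>\<psi>\<close> that fixes \<open>X\<close> and
  kills \<open>V\<close> (\<open>fixing_vanishing_on\<close>). For \<open>v\<close> in \<open>V \<subseteq> C\<close> therefore \<open>\<phi> v = \<phi> (\<psi> v) = 0\<close>.

  Both \<open>\<phi>\<close> and \<open>\<psi>\<close> come from one extension theorem of Arveson--Wittstock type
  (\<open>extension_dominated_by_ball\<close>), which produces maps controlled by the unit ball of a matrix
  seminorm: a quotient seminorm for \<open>\<psi>\<close>, a minimal one, found by Zorn's lemma, for \<open>\<phi>\<close>.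
  It is a Hahn--Banach argument on \<open>H \<otimes> B(H) \<otimes> H\<close>.

  Everything up to the last sections is done with real scalars, on the algebra of all bounded
  real-linear operators. The complex structure is recovered at the end, because the complex
  multiples of the identity belong to \<open>X\<close> and the kernel of \<open>\<phi>\<close> is an ideal of \<open>C\<close>.\<close>
section \<open>Operators on real Hilbert spaces\<close>

text \<open>The representing vector minimizes \<open>(norm x)\<^sup>2 - 2 * f x\<close>.\<close>
lemma riesz_representation:
  fixes f :: "'a::{real_inner,complete_space} \<Rightarrow> real"
  assumes "bounded_linear f"
  shows "\<exists>z. \<forall>x. f x = inner z x"
proof -
  interpret f: bounded_linear f by fact
  obtain K where K: "K > 0" "\<And>x. norm (f x) \<le> norm x * K"
    using f.pos_bounded by blast
  define E where "E x = (norm x)\<^sup>2 - 2 * f x" for x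
  have E_lower: "E x \<ge> - K\<^sup>2" for x
  proof -
    have "(norm x - K)\<^sup>2 \<ge> 0" by simp
    then have "(norm x)\<^sup>2 - 2 * (norm x * K) \<ge> - K\<^sup>2"
      by (simp add: power2_diff)
    moreover have "f x \<le> norm x * K" using K(2)[of x] by simp
    ultimately show ?thesis unfolding E_def by linarith
  qed
  define d where "d = Inf (range E)"
  have bdd: "bdd_below (range E)" using E_lower by (auto intro!: bdd_belowI)
  have d_le: "d \<le> E x" for x unfolding d_def by (rule cInf_lower[OF _ bdd]) simp
  have "\<exists>x. E x < d + 1 / Suc n" for n
    using cInf_lessD[of "range E" "d + 1 / Suc n"] by (auto simp: d_def)
  then obtain X where X: "\<And>n. E (X n) < d + 1 / Suc n" by metis
  \<comment> \<open>The parallelogram law turns a minimizing sequence into a Cauchy sequence.\<close>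
  have close: "(norm (X m - X n))\<^sup>2 \<le> 2 / Suc m + 2 / Suc n" for m n
  proof -
    have "(norm (X m - X n))\<^sup>2 = 2 * E (X m) + 2 * E (X n) - 4 * E ((1/2) *\<^sub>R (X m + X n))"
      unfolding E_def
      by (simp add: power2_norm_eq_inner inner_simps f.add f.scaleR inner_commute algebra_simps)
    with d_le[of "(1/2) *\<^sub>R (X m + X n)"] X[of m] X[of n]
    show ?thesis by simp
  qed
  have "Cauchy X"
  proof (rule CauchyI)
    fix e :: real assume e: "e > 0"
    obtain N where N: "4 / e\<^sup>2 < real N" using reals_Archimedean2 by blast
    show "\<exists>N. \<forall>m\<ge>N. \<forall>n\<ge>N. norm (X m - X n) < e"
    proof (intro exI allI impI)
      fix m n assume mn: "N \<le> m" "N \<le> n"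
      have Npos: "real N > 0" using N e by (smt (verit) divide_pos_pos zero_less_power)
      have *: "2 / real (Suc k) < 2 / N" if "N \<le> k" for k
        using that Npos by (intro divide_strict_left_mono) auto
      have "(norm (X m - X n))\<^sup>2 < 4 / N"
        using close[of m n] *[OF mn(1)] *[OF mn(2)] by linarith
      also have "\<dots> < e\<^sup>2" using N e Npos by (simp add: field_simps)
      finally show "norm (X m - X n) < e"
        using e power2_less_imp_less by (smt (verit))
    qed
  qed
  then obtain z where z: "X \<longlonglongrightarrow> z"
    using Cauchy_convergent convergent_def by blast
  have "(\<lambda>n. E (X n)) \<longlonglongrightarrow> E z"
    unfolding E_def by (intro tendsto_intros z f.tendsto)
  moreover have "(\<lambda>n. d + 1 / Suc n) \<longlonglongrightarrow> d + 0"
    by (intro tendsto_intros LIMSEQ_Suc[OF lim_const_over_n])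
  ultimately have "E z \<le> d"
    using X by (intro LIMSEQ_le[of "\<lambda>n. E (X n)" "E z" "\<lambda>n. d + 1 / Suc n" d]) (auto intro: less_imp_le)
  then have min: "E z \<le> E x" for x using d_le order_trans by blast
  \<comment> \<open>First variation at the minimum.\<close>
  have "f y = inner z y" for y
  proof -
    have quad: "0 \<le> t\<^sup>2 * (norm y)\<^sup>2 + 2 * t * (inner z y - f y)" for t
      using min[of "z + t *\<^sub>R y"] unfolding E_def power2_norm_eq_inner
      by (simp add: inner_simps f.add f.scaleR inner_commute algebra_simps power2_eq_square)
    define c where "c = inner z y - f y"
    have "c = 0"
    proof (rule ccontr)
      assume "c \<noteq> 0"
      define s where "s = - c / ((norm y)\<^sup>2 + 1)"
      have pos: "(norm y)\<^sup>2 + 1 > 0" by (simp add: add_nonneg_pos)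
      have sc: "s * ((norm y)\<^sup>2 + 1) = - c" using pos by (simp add: s_def)
      have "0 \<le> s\<^sup>2 * (norm y)\<^sup>2 + 2 * s * c" using quad[of s] c_def by simp
      also have "\<dots> \<le> s * (s * ((norm y)\<^sup>2 + 1)) + 2 * s * c" by (simp add: power2_eq_square algebra_simps)
      also have "\<dots> = s * c" unfolding sc by simp
      also have "\<dots> = - (c\<^sup>2 / ((norm y)\<^sup>2 + 1))" by (simp add: s_def power2_eq_square)
      also have "\<dots> < 0" using \<open>c \<noteq> 0\<close> pos by simp
      finally show False by simp
    qed
    then show ?thesis by (simp add: c_def)
  qed
  then show ?thesis by blast
qed

lemma operator_of_form:
  fixes b :: "'a::{real_inner,complete_space} \<Rightarrow> 'a \<Rightarrow> real"
  assumes "bounded_bilinear b"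
  shows "\<exists>T :: 'a \<Rightarrow>\<^sub>L 'a. \<forall>x y. inner (blinfun_apply T y) x = b x y"
proof -
  interpret b: bounded_bilinear b by fact
  obtain K where K: "K \<ge> 0" "\<And>x y. norm (b x y) \<le> norm x * norm y * K"
    using b.nonneg_bounded by blast
  have "\<exists>z. \<forall>x. b x y = inner z x" for y
    by (rule riesz_representation[OF b.bounded_linear_left])
  then obtain T where T: "\<And>x y. b x y = inner (T y) x" by metis
  have "bounded_linear T"
  proof (rule bounded_linear_intro)
    show "T (y + z) = T y + T z" for y z
      by (rule vector_eq_ldot[THEN iffD1]) (metis T b.add_right inner_add_left inner_commute)
    show "T (r *\<^sub>R y) = r *\<^sub>R T y" for r y
      by (rule vector_eq_ldot[THEN iffD1])
        (metis T b.scaleR_right inner_scaleR_left inner_commute real_scaleR_def)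
    show "norm (T y) \<le> norm y * K" for y
    proof -
      have "norm (T y) * norm (T y) \<le> norm (T y) * (norm y * K)"
        using K(2)[of "T y" y] T[of "T y" y] by (simp add: dot_square_norm power2_eq_square mult_ac)
      then show ?thesis
        using K(1) by (metis mult_le_cancel_left_pos norm_ge_zero order_le_less mult_nonneg_nonneg)
    qed
  qed
  then show ?thesis
    by (intro exI[of _ "Blinfun T"]) (simp add: bounded_linear_Blinfun_apply T)
qed

text \<open>The adjoint for the real inner product. On complex-linear operators it agrees with \<open>hadjoint\<close>
  (\<open>hadjoint_eq_adj\<close>).\<close>
definition adj :: "('a::{real_inner,complete_space} \<Rightarrow>\<^sub>L 'a) \<Rightarrow> ('a \<Rightarrow>\<^sub>L 'a)" where
  "adj A = (SOME B. \<forall>x y. inner (blinfun_apply B y) x = inner y (blinfun_apply A x))"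

lemma inner_adj: "inner (blinfun_apply (adj A) y) x = inner y (blinfun_apply A x)"
proof -
  have "bounded_bilinear (\<lambda>x y. inner y (blinfun_apply A x))"
    using bounded_bilinear.comp1[OF bounded_bilinear_inner[THEN bounded_bilinear.flip] blinfun.bounded_linear_right] .
  from someI_ex[OF operator_of_form[OF this]] show ?thesis
    unfolding adj_def by blast
qed

lemma inner_adj_right: "inner x (blinfun_apply (adj A) y) = inner (blinfun_apply A x) y"
  by (metis inner_adj inner_commute)

lemma blinfun_eq_by_inner:
  fixes A B :: "'a::real_inner \<Rightarrow>\<^sub>L 'a"
  assumes "\<And>x y. inner (blinfun_apply A y) x = inner (blinfun_apply B y) x"
  shows "A = B"
  by (rule blinfun_eqI, rule vector_eq_rdot[THEN iffD1]) (simp add: assms)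

lemma adj_eqI:
  assumes "\<And>x y. inner (blinfun_apply B y) x = inner y (blinfun_apply A x)"
  shows "adj A = B"
  by (rule blinfun_eq_by_inner) (simp add: assms inner_adj)

lemma adj_simps:
  "adj (adj A) = A" "adj (A + B) = adj A + adj B" "adj (r *\<^sub>R A) = r *\<^sub>R adj A"
  "adj (A o\<^sub>L B) = adj B o\<^sub>L adj A" "adj 0 = 0" "adj id_blinfun = id_blinfun"
  "adj (A - B) = adj A - adj B"
  by (rule adj_eqI; simp add: inner_adj inner_adj_right blinfun.bilinear_simps inner_simps)+

lemma norm_adj: "norm (adj A) = norm A"
proof -
  have le: "norm (adj B) \<le> norm B" for B :: "'a \<Rightarrow>\<^sub>L 'a"
  proof (rule norm_blinfun_bound)
    fix y
    let ?z = "blinfun_apply (adj B) y"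
    have "norm ?z * norm ?z = inner y (blinfun_apply B ?z)"
      by (metis inner_adj dot_square_norm power2_eq_square)
    also have "\<dots> \<le> norm y * norm (blinfun_apply B ?z)" by (rule norm_cauchy_schwarz)
    also have "\<dots> \<le> norm y * (norm B * norm ?z)" by (intro mult_left_mono norm_blinfun) simp
    finally have "norm ?z * norm ?z \<le> norm ?z * (norm B * norm y)" by (simp add: mult_ac)
    then show "norm ?z \<le> norm B * norm y"
      by (metis mult_le_cancel_left_pos norm_ge_zero order_le_less mult_nonneg_nonneg)
  qed simp
  show ?thesis by (metis le adj_simps(1) order_antisym)
qed

lemma bounded_linear_adj: "bounded_linear adj"
  by (rule bounded_linear_intro[where K = 1]) (simp_all add: adj_simps norm_adj)

section \<open>Matrix norms\<close>

abbreviation sqn :: "nat \<Rightarrow> (nat \<Rightarrow> 'a::real_normed_vector) \<Rightarrow> real" where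
  "sqn n \<xi> \<equiv> \<Sum>i<n. (norm (\<xi> i))\<^sup>2"

abbreviation mat_apply ::
  "nat \<Rightarrow> (nat \<Rightarrow> nat \<Rightarrow> ('a::real_normed_vector \<Rightarrow>\<^sub>L 'a)) \<Rightarrow> (nat \<Rightarrow> 'a) \<Rightarrow> nat \<Rightarrow> 'a" where
  "mat_apply n a \<xi> i \<equiv> \<Sum>j<n. blinfun_apply (a i j) (\<xi> j)"

lemma sqn_nonneg: "0 \<le> sqn n \<xi>" by (simp add: sum_nonneg)

lemma mat_norm_bdd:
  fixes a :: "nat \<Rightarrow> nat \<Rightarrow> ('h::chilbert_space \<Rightarrow>\<^sub>L 'h)"
  shows "bdd_above ((\<lambda>\<xi>. sqrt (sqn n (mat_apply n a \<xi>))) ` {\<xi>. sqn n \<xi> \<le> 1})"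
proof (rule bdd_aboveI2)
  fix \<xi> :: "nat \<Rightarrow> 'h" assume "\<xi> \<in> {\<xi>. sqn n \<xi> \<le> 1}"
  then have s: "sqn n \<xi> \<le> 1" by simp
  have "(norm (\<xi> j))\<^sup>2 \<le> 1" if "j < n" for j
    using member_le_sum[of j "{..<n}" "\<lambda>j. (norm (\<xi> j))\<^sup>2"] that s by simp
  then have u: "norm (\<xi> j) \<le> 1" if "j < n" for j
    using that power_le_one_iff[of "norm (\<xi> j)" 2] by simp
  have v: "norm (mat_apply n a \<xi> i) \<le> (\<Sum>j<n. norm (a i j))" for i
  proof (rule sum_norm_le)
    fix j assume "j \<in> {..<n}"
    then have "norm (a i j) * norm (\<xi> j) \<le> norm (a i j) * 1" using u by (intro mult_left_mono) auto
    then show "norm (blinfun_apply (a i j) (\<xi> j)) \<le> norm (a i j)"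
      using norm_blinfun[of "a i j" "\<xi> j"] by simp
  qed
  then show "sqrt (sqn n (mat_apply n a \<xi>)) \<le> sqrt (\<Sum>i<n. (\<Sum>j<n. norm (a i j))\<^sup>2)"
    by (intro real_sqrt_le_mono sum_mono power_mono) auto
qed

lemma mat_norm_ge:
  assumes "sqn n \<xi> \<le> 1"
  shows "sqrt (sqn n (mat_apply n a \<xi>)) \<le> mat_norm n a"
  unfolding mat_norm_def using assms by (intro cSUP_upper mat_norm_bdd) simp

lemma mat_norm_nonneg: "0 \<le> mat_norm n a"
  using mat_norm_ge[of "\<lambda>_. 0" n a] by (simp add: blinfun.bilinear_simps)

lemma mat_norm_bound: "sqn n (mat_apply n a \<xi>) \<le> (mat_norm n a)\<^sup>2 * sqn n \<xi>"
proof (cases "sqn n \<xi> = 0")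
  case True
  then have "\<xi> j = 0" if "j < n" for j using that by (simp add: sum_nonneg_eq_0_iff)
  then show ?thesis using True by (simp add: blinfun.bilinear_simps)
next
  case False
  define s where "s = sqrt (sqn n \<xi>)"
  have s: "s > 0" "s\<^sup>2 = sqn n \<xi>" using False sqn_nonneg[of \<xi> n] by (auto simp: s_def order_le_less)
  define \<zeta> where "\<zeta> i = (1/s) *\<^sub>R \<xi> i" for i
  have "sqn n \<zeta> = (1/s)\<^sup>2 * sqn n \<xi>"
    unfolding \<zeta>_def by (simp add: power_mult_distrib power_divide sum_divide_distrib)
  then have "sqn n \<zeta> \<le> 1" using s by (simp add: power_divide)
  then have *: "sqrt (sqn n (mat_apply n a \<zeta>)) \<le> mat_norm n a" by (rule mat_norm_ge)
  have "mat_apply n a \<zeta> i = (1/s) *\<^sub>R mat_apply n a \<xi> i" for i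
    unfolding \<zeta>_def by (simp add: blinfun.bilinear_simps scaleR_sum_right)
  then have "sqn n (mat_apply n a \<zeta>) = (1/s)\<^sup>2 * sqn n (mat_apply n a \<xi>)"
    by (simp add: power_divide sum_divide_distrib)
  moreover have "sqn n (mat_apply n a \<zeta>) \<le> (mat_norm n a)\<^sup>2"
    using * sqrt_le_D by blast
  moreover have "sqn n \<xi> > 0" using s by (metis zero_less_power)
  ultimately show ?thesis using s by (simp add: power_divide pos_divide_le_eq)
qed

lemma mat_norm_le:
  assumes "0 \<le> c" "\<And>\<xi>. sqn n (mat_apply n a \<xi>) \<le> c\<^sup>2 * sqn n \<xi>"
  shows "mat_norm n a \<le> c"
  unfolding mat_norm_def
proof (rule cSUP_least)
  show "{\<xi>::nat \<Rightarrow> 'a. sqn n \<xi> \<le> 1} \<noteq> {}" by (auto intro!: exI[of _ "\<lambda>_. 0"])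
  fix \<xi> :: "nat \<Rightarrow> 'a" assume "\<xi> \<in> {\<xi>. sqn n \<xi> \<le> 1}"
  then have "c\<^sup>2 * sqn n \<xi> \<le> c\<^sup>2 * 1" by (intro mult_left_mono) auto
  with assms(2)[of \<xi>] have "sqn n (mat_apply n a \<xi>) \<le> c\<^sup>2" by linarith
  then show "sqrt (sqn n (mat_apply n a \<xi>)) \<le> c" using assms(1) by (simp add: real_le_lsqrt)
qed

text \<open>The bilinear form on \<open>H\<^sup>n\<close> of a matrix of operators. Estimates of this form are linear in the matrix,
  which makes it easier to handle than the norm of the image vector.\<close>
definition mat_form ::
  "nat \<Rightarrow> (nat \<Rightarrow> nat \<Rightarrow> ('a::real_inner \<Rightarrow>\<^sub>L 'a)) \<Rightarrow> (nat \<Rightarrow> 'a) \<Rightarrow> (nat \<Rightarrow> 'a) \<Rightarrow> real" where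
  "mat_form n a \<xi> \<zeta> = (\<Sum>i<n. \<Sum>j<n. inner (blinfun_apply (a i j) (\<xi> j)) (\<zeta> i))"

lemma mat_form_apply: "mat_form n a \<xi> \<zeta> = (\<Sum>i<n. inner (mat_apply n a \<xi> i) (\<zeta> i))"
  by (simp add: mat_form_def inner_sum_left)

text \<open>The additive bound, in place of the product of the norms of \<open>\<xi>\<close> and \<open>\<zeta>\<close>, is what adds up
  over direct sums; the two are equivalent by rescaling the vectors.\<close>
lemma mat_norm_le_iff_form:
  fixes a :: "nat \<Rightarrow> nat \<Rightarrow> ('h::chilbert_space \<Rightarrow>\<^sub>L 'h)"
  assumes "c > 0"
  shows "mat_norm n a \<le> c \<longleftrightarrow> (\<forall>\<xi> \<zeta>. mat_form n a \<xi> \<zeta> \<le> c * (sqn n \<xi> + sqn n \<zeta>) / 2)"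
proof
  assume le: "mat_norm n a \<le> c"
  show "\<forall>\<xi> \<zeta>. mat_form n a \<xi> \<zeta> \<le> c * (sqn n \<xi> + sqn n \<zeta>) / 2"
  proof (intro allI)
    fix \<xi> \<zeta> :: "nat \<Rightarrow> 'h"
    let ?v = "mat_apply n a \<xi>"
    have "(mat_norm n a)\<^sup>2 * sqn n \<xi> \<le> c\<^sup>2 * sqn n \<xi>"
      using le by (intro mult_right_mono power_mono mat_norm_nonneg sqn_nonneg)
    then have v: "sqn n ?v \<le> c\<^sup>2 * sqn n \<xi>" using mat_norm_bound[of a \<xi> n] by linarith
    have "inner (?v i) (\<zeta> i) \<le> (1/(2*c)) * (norm (?v i))\<^sup>2 + (c/2) * (norm (\<zeta> i))\<^sup>2" for i
    proof -
      have "0 \<le> (norm (?v i - c *\<^sub>R \<zeta> i))\<^sup>2" by simp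
      also have "\<dots> = (norm (?v i))\<^sup>2 - 2 * c * inner (?v i) (\<zeta> i) + c\<^sup>2 * (norm (\<zeta> i))\<^sup>2"
        unfolding power2_norm_eq_inner
        by (simp add: inner_diff_left inner_diff_right inner_commute power2_eq_square algebra_simps)
      finally show ?thesis using assms by (simp add: field_simps power2_eq_square)
    qed
    then have "mat_form n a \<xi> \<zeta> \<le> (\<Sum>i<n. (1/(2*c)) * (norm (?v i))\<^sup>2 + (c/2) * (norm (\<zeta> i))\<^sup>2)"
      unfolding mat_form_apply by (intro sum_mono)
    also have "\<dots> = (1/(2*c)) * sqn n ?v + (c/2) * sqn n \<zeta>"
      by (simp only: sum.distrib sum_distrib_left)
    also have "\<dots> \<le> (1/(2*c)) * (c\<^sup>2 * sqn n \<xi>) + (c/2) * sqn n \<zeta>"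
      using v assms by (intro add_right_mono mult_left_mono) auto
    also have "\<dots> = c * (sqn n \<xi> + sqn n \<zeta>) / 2"
      using assms by (simp add: field_simps power2_eq_square)
    finally show "mat_form n a \<xi> \<zeta> \<le> c * (sqn n \<xi> + sqn n \<zeta>) / 2" .
  qed
next
  assume R: "\<forall>\<xi> \<zeta>. mat_form n a \<xi> \<zeta> \<le> c * (sqn n \<xi> + sqn n \<zeta>) / 2"
  show "mat_norm n a \<le> c"
  proof (rule mat_norm_le)
    fix \<xi> :: "nat \<Rightarrow> 'h"
    let ?v = "mat_apply n a \<xi>"
    \<comment> \<open>The vector \<open>\<zeta> = a \<xi> / c\<close> makes the form bound optimal.\<close>
    have 1: "mat_form n a \<xi> (\<lambda>i. (1/c) *\<^sub>R ?v i) = (1/c) * sqn n ?v"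
      unfolding mat_form_apply by (simp add: dot_square_norm sum_divide_distrib)
    have 2: "sqn n (\<lambda>i. (1/c) *\<^sub>R ?v i) = (1/c)\<^sup>2 * sqn n ?v"
      by (simp add: power_divide sum_divide_distrib)
    have "(1/c) * sqn n ?v \<le> c * (sqn n \<xi> + (1/c)\<^sup>2 * sqn n ?v) / 2"
      using R[rule_format, of \<xi> "\<lambda>i. (1/c) *\<^sub>R ?v i"] unfolding 1 2 .
    then show "sqn n ?v \<le> c\<^sup>2 * sqn n \<xi>"
      using assms by (simp add: field_simps power2_eq_square)
  qed (use assms in simp)
qed

lemma mat_norm_scale: "mat_norm n (\<lambda>i j. r *\<^sub>R a i j) = \<bar>r\<bar> * mat_norm n a"
proof -
  have le: "mat_norm n (\<lambda>i j. r *\<^sub>R a i j) \<le> \<bar>r\<bar> * mat_norm n a" for r and a :: "nat \<Rightarrow> nat \<Rightarrow> ('a \<Rightarrow>\<^sub>L 'a)"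
  proof (rule mat_norm_le)
    show "0 \<le> \<bar>r\<bar> * mat_norm n a" by (simp add: mat_norm_nonneg)
    fix \<xi>
    have "sqn n (mat_apply n (\<lambda>i j. r *\<^sub>R a i j) \<xi>) = r\<^sup>2 * sqn n (mat_apply n a \<xi>)"
      by (simp add: blinfun.bilinear_simps flip: scaleR_sum_right)
         (simp add: power_mult_distrib sum_distrib_left)
    also have "\<dots> \<le> r\<^sup>2 * ((mat_norm n a)\<^sup>2 * sqn n \<xi>)" by (intro mult_left_mono mat_norm_bound) simp
    finally show "sqn n (mat_apply n (\<lambda>i j. r *\<^sub>R a i j) \<xi>) \<le> (\<bar>r\<bar> * mat_norm n a)\<^sup>2 * sqn n \<xi>"
      by (simp add: power_mult_distrib mult_ac)
  qed
  show ?thesis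
  proof (cases "r = 0")
    case True
    then show ?thesis using le[of 0 a] mat_norm_nonneg[of n "\<lambda>i j. 0 *\<^sub>R a i j"] by (intro order_antisym) auto
  next
    case False
    have "mat_norm n a \<le> \<bar>1/r\<bar> * mat_norm n (\<lambda>i j. r *\<^sub>R a i j)"
      using le[of "1/r" "\<lambda>i j. r *\<^sub>R a i j"] False by simp
    then have "\<bar>r\<bar> * mat_norm n a \<le> mat_norm n (\<lambda>i j. r *\<^sub>R a i j)"
      using False by (simp add: field_simps)
    then show ?thesis using le[of r a] by simp
  qed
qed

lemma mat_norm_add: "mat_norm n (\<lambda>i j. a i j + b i j) \<le> mat_norm n a + mat_norm n b"
proof (rule field_le_epsilon)
  fix e :: real assume e: "e > 0"
  define c d where "c = mat_norm n a + e/2" "d = mat_norm n b + e/2"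
  have pos: "c > 0" "d > 0" using e mat_norm_nonneg[of n a] mat_norm_nonneg[of n b] by (simp_all add: c_d_def)
  have ab: "mat_norm n a \<le> c" "mat_norm n b \<le> d" using e by (simp_all add: c_d_def)
  have "mat_norm n (\<lambda>i j. a i j + b i j) \<le> c + d"
    unfolding mat_norm_le_iff_form[OF add_pos_pos[OF pos]]
  proof (intro allI)
    fix \<xi> \<zeta>
    have "mat_form n (\<lambda>i j. a i j + b i j) \<xi> \<zeta> = mat_form n a \<xi> \<zeta> + mat_form n b \<xi> \<zeta>"
      by (simp add: mat_form_def blinfun.bilinear_simps inner_add_left sum.distrib)
    then show "mat_form n (\<lambda>i j. a i j + b i j) \<xi> \<zeta> \<le> (c + d) * (sqn n \<xi> + sqn n \<zeta>) / 2"
      using ab[unfolded mat_norm_le_iff_form[OF pos(1)] mat_norm_le_iff_form[OF pos(2)], rule_format, of \<xi> \<zeta>]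
      by (simp add: algebra_simps add_divide_distrib)
  qed
  then show "mat_norm n (\<lambda>i j. a i j + b i j) \<le> mat_norm n a + mat_norm n b + e"
    by (simp add: c_d_def)
qed

lemma mat_norm_one: "mat_norm 1 (\<lambda>i j. A) = norm A"
proof (rule antisym)
  show "mat_norm 1 (\<lambda>i j. A) \<le> norm A"
    by (rule mat_norm_le) (auto simp: power_mult_distrib[symmetric] intro!: power_mono norm_blinfun)
  show "norm A \<le> mat_norm 1 (\<lambda>i j. A)"
  proof (rule norm_blinfun_bound[OF mat_norm_nonneg])
    fix x
    have "(norm (blinfun_apply A x))\<^sup>2 \<le> (mat_norm 1 (\<lambda>i j. A) * norm x)\<^sup>2"
      using mat_norm_bound[of "\<lambda>i j. A" "\<lambda>_. x" 1] by (simp add: power_mult_distrib)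
    then show "norm (blinfun_apply A x) \<le> mat_norm 1 (\<lambda>i j. A) * norm x"
      by (rule power2_le_imp_le) (simp add: mat_norm_nonneg)
  qed
qed

lemma mat_norm_cong:
  assumes "\<And>i j. i < n \<Longrightarrow> j < n \<Longrightarrow> a i j = b i j"
  shows "mat_norm n a = mat_norm n b"
proof -
  have "mat_apply n a \<xi> i = mat_apply n b \<xi> i" if "i < n" for \<xi> i
    using assms that by (intro sum.cong) auto
  then show ?thesis unfolding mat_norm_def by (intro SUP_cong) auto
qed

section \<open>Functionals dominated on a convex cone\<close>

text \<open>Tensors will be represented by functions, hence the pointwise vector space structure.\<close>
instantiation "fun" :: (type, real_vector) real_vector
begin

definition scaleR_fun :: "real \<Rightarrow> ('a \<Rightarrow> 'b) \<Rightarrow> 'a \<Rightarrow> 'b" where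
  "scaleR_fun r f = (\<lambda>x. r *\<^sub>R f x)"

instance
  by standard (simp_all add: scaleR_fun_def fun_eq_iff algebra_simps)

end

text \<open>A cone that is maximal among the cones avoiding \<open>- u\<close> contains one of \<open>z\<close>, \<open>- z\<close> for every \<open>z\<close>;
  it is the upper half space of a linear functional. Zorn's lemma enters the Hahn--Banach theorem here.\<close>
lemma maximal_cone_total:
  fixes G :: "'e::real_vector set"
  assumes add: "\<And>a b. a \<in> G \<Longrightarrow> b \<in> G \<Longrightarrow> a + b \<in> G"
    and scale: "\<And>a c. a \<in> G \<Longrightarrow> 0 \<le> c \<Longrightarrow> c *\<^sub>R a \<in> G"
    and u: "u \<in> G" "- u \<notin> G"
  shows "\<exists>M. G \<subseteq> M \<and> (\<forall>a\<in>M. \<forall>b\<in>M. a + b \<in> M) \<and> (\<forall>a\<in>M. \<forall>c\<ge>0. c *\<^sub>R a \<in> M) \<and>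
    - u \<notin> M \<and> (\<forall>z. z \<in> M \<or> - z \<in> M)"
proof -
  define cone where "cone M \<longleftrightarrow> (\<forall>a\<in>M. \<forall>b\<in>M. a + b \<in> M) \<and> (\<forall>a\<in>M. \<forall>c\<ge>0. c *\<^sub>R a \<in> M)" for M :: "'e set"
  define \<A> where "\<A> = {M. G \<subseteq> M \<and> cone M \<and> - u \<notin> M}"
  have "\<exists>M\<in>\<A>. \<forall>X\<in>\<A>. M \<subseteq> X \<longrightarrow> X = M"
  proof (rule subset_Zorn_nonempty)
    have "cone G" unfolding cone_def by (intro conjI ballI allI impI add scale)
    then have "G \<in> \<A>" unfolding \<A>_def using u(2) by simp
    then show "\<A> \<noteq> {}" by blast
    fix \<C> assume \<C>: "\<C> \<noteq> {}" "subset.chain \<A> \<C>"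
    then have sub: "M \<in> \<A>" if "M \<in> \<C>" for M using that unfolding subset.chain_def by blast
    have "a + b \<in> \<Union>\<C>" if ab: "a \<in> \<Union>\<C>" "b \<in> \<Union>\<C>" for a b
    proof -
      obtain M N where MN: "M \<in> \<C>" "N \<in> \<C>" "a \<in> M" "b \<in> N" using ab by blast
      then have "M \<subseteq> N \<or> N \<subseteq> M" using \<C>(2) unfolding subset.chain_def by blast
      then obtain L where "L \<in> \<C>" "a \<in> L" "b \<in> L" using MN by blast
      moreover from this have "cone L" using sub unfolding \<A>_def by blast
      ultimately show ?thesis unfolding cone_def by blast
    qed
    moreover have "c *\<^sub>R a \<in> \<Union>\<C>" if a: "a \<in> \<Union>\<C>" and c: "c \<ge> 0" for a c
    proof -
      obtain M where "M \<in> \<C>" "a \<in> M" using a by blast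
      moreover from this have "cone M" using sub unfolding \<A>_def by blast
      ultimately show ?thesis using c unfolding cone_def by blast
    qed
    ultimately have "cone (\<Union>\<C>)" unfolding cone_def by blast
    moreover have "G \<subseteq> \<Union>\<C>" using \<C>(1) sub unfolding \<A>_def by blast
    moreover have "- u \<notin> \<Union>\<C>" using sub unfolding \<A>_def by blast
    ultimately show "\<Union>\<C> \<in> \<A>" unfolding \<A>_def by simp
  qed
  then obtain M where M: "M \<in> \<A>" and max: "\<And>X. X \<in> \<A> \<Longrightarrow> M \<subseteq> X \<Longrightarrow> X = M" by blast
  have Madd: "a + b \<in> M" if "a \<in> M" "b \<in> M" for a b using M that unfolding \<A>_def cone_def by blast
  have Mscale: "c *\<^sub>R a \<in> M" if "a \<in> M" "c \<ge> 0" for a c using M that unfolding \<A>_def cone_def by blast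
  have Mu: "u \<in> M" "- u \<notin> M" using M u(1) unfolding \<A>_def by blast+
  have "0 \<in> M" using Mscale[OF Mu(1), of 0] by simp
  have "- z \<in> M" if "z \<notin> M" for z
  proof -
    define N where "N = {m + c *\<^sub>R z |m c. m \<in> M \<and> c \<ge> 0}"
    have "M \<subseteq> N"
    proof
      fix m assume "m \<in> M"
      then show "m \<in> N" unfolding N_def by (intro CollectI exI[of _ m] exI[of _ 0]) simp
    qed
    have "z \<in> N" unfolding N_def using \<open>0 \<in> M\<close> by (intro CollectI exI[of _ 0] exI[of _ 1]) simp
    \<comment> \<open>If the cone generated by \<open>M\<close> and \<open>z\<close> avoided \<open>- u\<close>, it would contradict maximality.\<close>
    have "- u \<in> N"
    proof (rule ccontr)
      assume nu: "- u \<notin> N"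
      have "a + b \<in> N" if "a \<in> N" "b \<in> N" for a b
      proof -
        obtain m c m' c' where "a = m + c *\<^sub>R z" "b = m' + c' *\<^sub>R z" "m \<in> M" "m' \<in> M" "c \<ge> 0" "c' \<ge> 0"
          using \<open>a \<in> N\<close> \<open>b \<in> N\<close> unfolding N_def by blast
        then show ?thesis unfolding N_def using Madd
          by (intro CollectI exI[of _ "m + m'"] exI[of _ "c + c'"]) (simp add: algebra_simps)
      qed
      moreover have "d *\<^sub>R a \<in> N" if "a \<in> N" "d \<ge> 0" for a d
      proof -
        obtain m c where "a = m + c *\<^sub>R z" "m \<in> M" "c \<ge> 0"
          using \<open>a \<in> N\<close> unfolding N_def by blast
        then show ?thesis unfolding N_def using Mscale \<open>d \<ge> 0\<close>
          by (intro CollectI exI[of _ "d *\<^sub>R m"] exI[of _ "d * c"]) (simp add: algebra_simps)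
      qed
      ultimately have "cone N" unfolding cone_def by blast
      then have "N \<in> \<A>"
        using nu M \<open>M \<subseteq> N\<close> unfolding \<A>_def by blast
      then show False using max[OF _ \<open>M \<subseteq> N\<close>] \<open>z \<in> N\<close> that by blast
    qed
    then obtain m c where mc: "- u = m + c *\<^sub>R z" "m \<in> M" "c \<ge> 0" unfolding N_def by blast
    have "c > 0" using mc Mu(2) by (cases "c = 0") auto
    have "- z = (1/c) *\<^sub>R (m + u)"
    proof -
      have "c *\<^sub>R (- z) = m + u" using arg_cong[OF mc(1), of "\<lambda>v. u - c *\<^sub>R z + v"] by (simp add: algebra_simps)
      then have "(1/c) *\<^sub>R (c *\<^sub>R (- z)) = (1/c) *\<^sub>R (m + u)" by simp
      then show ?thesis using \<open>c > 0\<close> by simp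
    qed
    then show ?thesis using Mscale Madd mc(2) Mu(1) \<open>c > 0\<close> by simp
  qed
  moreover have "G \<subseteq> M" using M unfolding \<A>_def by blast
  ultimately show ?thesis using Madd Mscale Mu(2) by (intro exI[of _ M]) blast
qed

text \<open>Hahn--Banach theorem for the convex cone \<open>G\<close>, read as a list of required inequalities
  \<open>g t \<le> q\<close>. They can be met as soon as they do not imply \<open>0 \<le> q\<close> for some negative \<open>q\<close>. The functional is linear on
  the subspace where \<open>G\<close> bounds it from both sides.\<close>
lemma dominated_functional:
  fixes G :: "('e::real_vector \<times> real) set"
  assumes zero: "(0, 0) \<in> G"
    and add: "\<And>s t p q. (s, p) \<in> G \<Longrightarrow> (t, q) \<in> G \<Longrightarrow> (s + t, p + q) \<in> G"
    and scale: "\<And>t q c. (t, q) \<in> G \<Longrightarrow> 0 \<le> c \<Longrightarrow> (c *\<^sub>R t, c * q) \<in> G"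
    and up: "\<And>t q r. (t, q) \<in> G \<Longrightarrow> q \<le> r \<Longrightarrow> (t, r) \<in> G"
    and sym: "\<And>t q. (t, q) \<in> G \<Longrightarrow> \<exists>r. (- t, r) \<in> G"
    and pos: "\<And>q. (0, q) \<in> G \<Longrightarrow> 0 \<le> q"
  shows "\<exists>g. (\<forall>(t, q)\<in>G. g t \<le> q) \<and>
    (\<forall>s\<in>fst ` G. \<forall>t\<in>fst ` G. g (s + t) = g s + g t) \<and>
    (\<forall>t\<in>fst ` G. \<forall>c. g (c *\<^sub>R t) = c * g t)"
proof -
  have "\<exists>M. G \<subseteq> M \<and> (\<forall>a\<in>M. \<forall>b\<in>M. a + b \<in> M) \<and> (\<forall>a\<in>M. \<forall>c\<ge>0. c *\<^sub>R a \<in> M) \<and>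
    - (0, 1) \<notin> M \<and> (\<forall>z. z \<in> M \<or> - z \<in> M)"
  proof (rule maximal_cone_total)
    show "(0, 1) \<in> G" using up[OF zero] by simp
    show "- (0, 1) \<notin> G" using pos[of "-1"] by auto
  qed (auto intro: add scale)
  then obtain M where GM: "G \<subseteq> M" and Madd0: "\<forall>a\<in>M. \<forall>b\<in>M. a + b \<in> M"
    and Mscale0: "\<forall>a\<in>M. \<forall>c\<ge>0. c *\<^sub>R a \<in> M"
    and Mu: "- (0, 1) \<notin> M" and tot0: "\<forall>z. z \<in> M \<or> - z \<in> M" by (elim exE conjE)
  have Madd: "\<And>a b. a \<in> M \<Longrightarrow> b \<in> M \<Longrightarrow> a + b \<in> M"
    and Mscale: "\<And>a c. a \<in> M \<Longrightarrow> c \<ge> 0 \<Longrightarrow> c *\<^sub>R a \<in> M"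
    and tot: "\<And>z. z \<in> M \<or> - z \<in> M" using Madd0 Mscale0 tot0 by blast+
  have M0: "0 \<le> q" if "(0, q) \<in> M" for q
  proof (rule ccontr)
    assume "\<not> 0 \<le> q"
    then have "(1 / \<bar>q\<bar>) *\<^sub>R (0, q) \<in> M" using that by (intro Mscale) auto
    then show False using Mu \<open>\<not> 0 \<le> q\<close> by auto
  qed
  define D where "D = fst ` G"
  define g where "g t = Inf {q. (t, q) \<in> M}" for t
  have Dneg: "- t \<in> D" if "t \<in> D" for t using that sym unfolding D_def by force
  have Dadd: "s + t \<in> D" if "s \<in> D" "t \<in> D" for s t using that add unfolding D_def by force
  have Dscale: "c *\<^sub>R t \<in> D" if "t \<in> D" "c \<ge> 0" for t c using that scale unfolding D_def by force
  have D_M: "\<exists>q. (t, q) \<in> M" if "t \<in> D" for t using that GM unfolding D_def by force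
  have bdd: "bdd_below {q. (t, q) \<in> M}" if t: "t \<in> D" for t
  proof -
    obtain r where r: "(- t, r) \<in> M" using D_M Dneg t by blast
    have "- r \<le> q" if "(t, q) \<in> M" for q
      using M0[of "q + r"] Madd[OF that r] by simp
    then show ?thesis by (intro bdd_belowI[of _ "- r"]) simp
  qed
  have g_le: "g t \<le> q" if "t \<in> D" "(t, q) \<in> M" for t q
    unfolding g_def using that bdd by (intro cInf_lower) auto
  have g_ge: "r \<le> g t" if "t \<in> D" "\<And>q. (t, q) \<in> M \<Longrightarrow> r \<le> q" for t r
    unfolding g_def using that D_M by (intro cInf_greatest) auto
  have g_lt: "\<exists>q. (t, q) \<in> M \<and> q < g t + e" if "t \<in> D" "e > 0" for t e
    using g_ge[of t "g t + e"] that by force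
  have sub: "g (s + t) \<le> g s + g t" if st: "s \<in> D" "t \<in> D" for s t
  proof (rule field_le_epsilon)
    fix e :: real assume "e > 0"
    then obtain p q where "(s, p) \<in> M" "p < g s + e/2" "(t, q) \<in> M" "q < g t + e/2"
      using g_lt[OF st(1), of "e/2"] g_lt[OF st(2), of "e/2"] by auto
    then show "g (s + t) \<le> g s + g t + e"
      using g_le[OF Dadd[OF st], of "p + q"] Madd[of "(s, p)" "(t, q)"] by simp
  qed
  \<comment> \<open>Subadditivity gives one inequality, totality of the maximal cone the other; a sublinear
    functional that is odd is linear.\<close>
  have neg: "g (- t) = - g t" if t: "t \<in> D" for t
  proof (rule antisym)
    show "g (- t) \<le> - g t"
    proof (rule dense_ge)
      fix r assume "- g t < r"
      then have "(t, - r) \<notin> M" using g_le[OF t] by force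
      then have "(- t, r) \<in> M" using tot[of "(t, - r)"] by simp
      then show "g (- t) \<le> r" using g_le Dneg t by blast
    qed
    have "0 \<in> D" using zero unfolding D_def by force
    then have "0 \<le> g 0" using g_ge M0 by blast
    then show "- g t \<le> g (- t)" using sub[OF t Dneg[OF t]] by simp
  qed
  have lin_add: "g (s + t) = g s + g t" if st: "s \<in> D" "t \<in> D" for s t
  proof (rule antisym[OF sub[OF st]])
    have "g (- (s + t)) \<le> g (- s) + g (- t)"
      using sub[OF Dneg[OF st(1)] Dneg[OF st(2)]] by simp
    then show "g s + g t \<le> g (s + t)" using neg[OF Dadd[OF st]] neg[OF st(1)] neg[OF st(2)] by linarith
  qed
  have pos_le: "g (c *\<^sub>R t) \<le> c * g t" if t: "t \<in> D" and c: "c > 0" for t c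
  proof -
    have "g (c *\<^sub>R t) / c \<le> g t"
    proof (rule g_ge[OF t])
      fix q assume "(t, q) \<in> M"
      then have "(c *\<^sub>R t, c * q) \<in> M" using Mscale[of "(t, q)" c] c by simp
      then show "g (c *\<^sub>R t) / c \<le> q" using g_le[OF Dscale[OF t]] c by (simp add: field_simps)
    qed
    then show ?thesis using c by (simp add: field_simps)
  qed
  have pos_eq: "g (c *\<^sub>R t) = c * g t" if t: "t \<in> D" and c: "c > 0" for t c
    using pos_le[OF t c] pos_le[OF Dneg[OF t] c] neg[OF t] neg[OF Dscale[OF t, of c]] c by simp
  have "g (c *\<^sub>R t) = c * g t" if t: "t \<in> D" for t c
  proof (cases "c = 0 \<or> c > 0")
    case True
    have "0 \<in> D" using zero unfolding D_def by force
    with lin_add[of 0 0] have "g 0 = 0" by simp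
    then show ?thesis using True pos_eq[OF t] by auto
  next
    case False
    then have "g ((- c) *\<^sub>R (- t)) = - c * g (- t)" using pos_eq[OF Dneg[OF t], of "- c"] by simp
    then show ?thesis using neg[OF t] by simp
  qed
  moreover have "\<forall>(t, q)\<in>G. g t \<le> q" using g_le GM unfolding D_def by force
  ultimately show ?thesis using lin_add unfolding D_def by blast
qed

section \<open>Coefficient projections\<close>

text \<open>Orthogonal projections of \<open>\<real>\<^sup>n\<close>. Rows and columns with index \<open>n\<close> or more are subject to the same
  equations, which saves index bounds.\<close>
definition coeff_proj :: "nat \<Rightarrow> (nat \<Rightarrow> nat \<Rightarrow> real) \<Rightarrow> bool" where
  "coeff_proj n P \<longleftrightarrow> (\<forall>i j. P i j = P j i) \<and> (\<forall>i j. (\<Sum>k<n. P i k * P k j) = P i j)"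

text \<open>The matrix \<open>P\<close> acts on \<open>H\<^sup>n\<close> as an orthogonal projection.\<close>
lemma coeff_proj_contraction:
  fixes \<xi> :: "nat \<Rightarrow> 'a::real_inner"
  assumes P: "coeff_proj n P"
  shows "sqn n (\<lambda>i. \<Sum>k<n. P i k *\<^sub>R \<xi> k) \<le> sqn n \<xi>"
proof -
  let ?p = "\<lambda>i. \<Sum>k<n. P i k *\<^sub>R \<xi> k"
  have PP: "(\<Sum>k<n. P i k * P k j) = P i j" "P i j = P j i" for i j
    using P unfolding coeff_proj_def by blast+
  have idem: "(\<Sum>k<n. P i k *\<^sub>R ?p k) = ?p i" for i
  proof -
    have "(\<Sum>k<n. P i k *\<^sub>R ?p k) = (\<Sum>k<n. \<Sum>j<n. (P i k * P k j) *\<^sub>R \<xi> j)"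
      by (simp add: scaleR_sum_right)
    also have "\<dots> = (\<Sum>j<n. (\<Sum>k<n. P i k * P k j) *\<^sub>R \<xi> j)"
      by (subst sum.swap) (simp add: scaleR_sum_left)
    finally show ?thesis by (simp only: PP(1))
  qed
  have "(\<Sum>i<n. inner (?p i) (\<xi> i)) = (\<Sum>i<n. \<Sum>k<n. P i k * inner (?p k) (\<xi> i))"
    by (subst idem[symmetric]) (simp add: inner_sum_left)
  also have "\<dots> = (\<Sum>k<n. \<Sum>i<n. P k i * inner (?p k) (\<xi> i))"
    by (subst sum.swap) (simp add: PP(2)[of _ _])
  also have "\<dots> = (\<Sum>k<n. inner (?p k) (?p k))" by (simp add: inner_sum_right)
  finally have eq: "(\<Sum>i<n. inner (?p i) (\<xi> i)) = sqn n ?p" by (simp add: power2_norm_eq_inner)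
  have "0 \<le> sqn n (\<lambda>i. \<xi> i - ?p i)" by (rule sqn_nonneg)
  also have "\<dots> = sqn n \<xi> - 2 * (\<Sum>i<n. inner (?p i) (\<xi> i)) + sqn n ?p"
  proof -
    have "(norm (\<xi> i - ?p i))\<^sup>2 = (norm (\<xi> i))\<^sup>2 - 2 * inner (?p i) (\<xi> i) + (norm (?p i))\<^sup>2" for i
      by (simp only: power2_norm_eq_inner inner_diff_left inner_diff_right inner_commute[of "\<xi> i" "?p i"])
    then show ?thesis by (simp add: sum.distrib sum_subtractf sum_distrib_left)
  qed
  finally show ?thesis using eq by simp
qed

text \<open>The vectors \<open>\<xi>\<close> define a map from \<open>H\<close> to \<open>\<real>\<^sup>n\<close>, \<open>x \<mapsto> (inner (\<xi> i) x)\<^sub>i\<close>. The projection onto its range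
  has rows in this range and leaves \<open>\<xi>\<close> unchanged. It is obtained as a projection with rows in the
  range of maximal trace: one that moves \<open>\<xi>\<close> can be enlarged by a projection of rank one,
  and the trace is at most \<open>n\<close>.\<close>
lemma coeff_proj_onto_range:
  fixes \<xi> :: "nat \<Rightarrow> 'a::real_inner"
  shows "\<exists>P x. coeff_proj n P \<and> (\<forall>k i. P k i = inner (\<xi> i) (x k)) \<and>
    (\<forall>i<n. (\<Sum>k<n. P i k *\<^sub>R \<xi> k) = \<xi> i)"
proof (rule ccontr)
  define good where "good P \<longleftrightarrow> coeff_proj n P \<and> (\<exists>x. \<forall>k i. P k i = inner (\<xi> i) (x k))" for P
  assume contra: "\<not> ?thesis"
  have step: "\<exists>P'. good P' \<and> (\<Sum>i<n. P' i i) = (\<Sum>i<n. P i i) + 1" if "good P" for P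
  proof -
    obtain x where x: "\<And>k i. P k i = inner (\<xi> i) (x k)" using \<open>good P\<close> unfolding good_def by blast
    have P: "\<And>i j. P i j = P j i" "\<And>i j. (\<Sum>k<n. P i k * P k j) = P i j"
      using \<open>good P\<close> unfolding good_def coeff_proj_def by blast+
    obtain i0 where i0: "i0 < n" "(\<Sum>k<n. P i0 k *\<^sub>R \<xi> k) \<noteq> \<xi> i0"
      using contra x \<open>good P\<close> unfolding good_def by blast
    define y where "y = \<xi> i0 - (\<Sum>k<n. P i0 k *\<^sub>R \<xi> k)"
    have "y \<noteq> 0" using i0 by (simp add: y_def)
    \<comment> \<open>The coefficients \<open>w\<close> of \<open>z\<close> lie in the range and are orthogonal to the range of \<open>P\<close>.\<close>
    define z where "z = y - (\<Sum>k<n. inner (\<xi> k) y *\<^sub>R x k)"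
    define w where "w i = inner (\<xi> i) z" for i
    have w: "w i = inner (\<xi> i) y - (\<Sum>k<n. P i k * inner (\<xi> k) y)" for i
      unfolding w_def z_def by (simp add: inner_diff_right inner_sum_right x[symmetric] P(1)[of _ i] mult.commute)
    have Pw: "(\<Sum>k<n. P i k * w k) = 0" for i
    proof -
      have "(\<Sum>k<n. P i k * w k) = (\<Sum>k<n. P i k * inner (\<xi> k) y) - (\<Sum>k<n. \<Sum>l<n. P i k * P k l * inner (\<xi> l) y)"
        unfolding w by (simp add: right_diff_distrib sum_subtractf sum_distrib_left mult.assoc)
      also have "(\<Sum>k<n. \<Sum>l<n. P i k * P k l * inner (\<xi> l) y) = (\<Sum>l<n. (\<Sum>k<n. P i k * P k l) * inner (\<xi> l) y)"
        by (subst sum.swap) (simp add: sum_distrib_right)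
      finally show ?thesis by (simp add: P(2))
    qed
    define s where "s = (\<Sum>k<n. w k * w k)"
    \<comment> \<open>The coefficient at \<open>i0\<close> shows that \<open>w\<close> is nonzero.\<close>
    have "w i0 = inner y y"
      unfolding w by (simp add: y_def inner_diff_left inner_sum_left)
    then have "w i0 \<noteq> 0" using \<open>y \<noteq> 0\<close> by simp
    have "s > 0"
      unfolding s_def using i0(1) \<open>w i0 \<noteq> 0\<close>
      by (intro sum_pos2[of _ i0]) (auto simp: zero_less_mult_iff not_less_iff_gr_or_eq)
    define P' where "P' i j = P i j + w i * w j / s" for i j
    have "(\<Sum>k<n. P' i k * P' k j) = P' i j" for i j
    proof -
      have "(\<Sum>k<n. P' i k * P' k j) = (\<Sum>k<n. P i k * P k j) + (\<Sum>k<n. P i k * w k) * w j / s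
         + w i * (\<Sum>k<n. P j k * w k) / s + w i * w j * s / (s * s)"
        unfolding P'_def s_def
        by (simp add: distrib_left distrib_right sum.distrib sum_distrib_left sum_distrib_right
             sum_divide_distrib P(1)[of _ j] mult_ac)
      then show ?thesis using \<open>s > 0\<close> by (simp add: Pw P(2) P'_def)
    qed
    then have "coeff_proj n P'" unfolding coeff_proj_def P'_def using P(1) by (simp add: mult.commute)
    moreover have "P' k i = inner (\<xi> i) (x k + (w k / s) *\<^sub>R z)" for k i
      by (simp add: P'_def x inner_add_right w_def)
    ultimately have "good P'"
      unfolding good_def by (intro conjI exI[of _ "\<lambda>k. x k + (w k / s) *\<^sub>R z"] allI)
    moreover have "(\<Sum>i<n. P' i i) = (\<Sum>i<n. P i i) + 1"
      using \<open>s > 0\<close> by (simp add: P'_def sum.distrib s_def flip: sum_divide_distrib)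
    ultimately show ?thesis by blast
  qed
  have "\<exists>P. good P \<and> (\<Sum>i<n. P i i) \<ge> real m" for m
  proof (induction m)
    case 0
    have "good (\<lambda>i j. 0)" unfolding good_def coeff_proj_def by (auto intro: exI[of _ "\<lambda>k. 0"])
    then show ?case by (intro exI[of _ "\<lambda>i j. 0"]) simp
  next
    case (Suc m)
    then obtain P where P: "good P" "real m \<le> (\<Sum>i<n. P i i)" by blast
    obtain P' where "good P'" "(\<Sum>i<n. P' i i) = (\<Sum>i<n. P i i) + 1" using step[OF P(1)] by blast
    then show ?case using P(2) by (intro exI[of _ P']) simp
  qed
  then obtain P where P: "good P" "(\<Sum>i<n. P i i) \<ge> real (Suc n)" by blast
  have "P i i \<le> 1" if "i < n" for i
  proof -
    have idem: "(\<Sum>k<n. P i k * P k i) = P i i" and symP: "P k i = P i k" for k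
      using P(1) unfolding good_def coeff_proj_def by blast+
    have "P i i = (\<Sum>k<n. P i k * P i k)"
      by (subst idem[symmetric]) (intro sum.cong refl arg_cong2[where f = "(*)"] symP)
    also have "\<dots> \<ge> P i i * P i i" using that by (intro member_le_sum) auto
    finally have "P i i * P i i \<le> P i i" .
    then show ?thesis using mult_strict_right_mono[of 1 "P i i" "P i i"] by linarith
  qed
  then have "(\<Sum>i<n. P i i) \<le> real (card {..<n}) * 1" by (intro sum_bounded_above) simp
  then show False using P(2) by simp
qed

section \<open>Tensors\<close>

text \<open>The elementary tensor \<open>\<zeta> \<otimes> a \<otimes> \<xi>\<close>. Its first component is the bilinear map that represents it; the
  second is the value of the pairing that corresponds to the identity map. Since the tensor records
  this value, the functional that is to be extended is simply \<open>snd\<close>, which makes it obviously well defined.\<close>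
definition elem_tensor ::
  "'a \<Rightarrow> ('a::real_inner \<Rightarrow>\<^sub>L 'a) \<Rightarrow> 'a \<Rightarrow> ('a \<Rightarrow> 'a \<Rightarrow> ('a \<Rightarrow>\<^sub>L 'a)) \<times> real" where
  "elem_tensor \<zeta> a \<xi> = (\<lambda>x y. (inner \<zeta> x * inner \<xi> y) *\<^sub>R a, inner (blinfun_apply a \<xi>) \<zeta>)"

definition tensor ::
  "nat \<Rightarrow> (nat \<Rightarrow> 'a) \<Rightarrow> (nat \<Rightarrow> nat \<Rightarrow> ('a::real_inner \<Rightarrow>\<^sub>L 'a)) \<Rightarrow> (nat \<Rightarrow> 'a)
    \<Rightarrow> ('a \<Rightarrow> 'a \<Rightarrow> ('a \<Rightarrow>\<^sub>L 'a)) \<times> real" where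
  "tensor n \<zeta> a \<xi> = (\<Sum>i<n. \<Sum>j<n. elem_tensor (\<zeta> i) (a i j) (\<xi> j))"

lemma elem_tensor_linear:
  "linear (\<lambda>\<zeta>. elem_tensor \<zeta> a \<xi>)" "linear (\<lambda>a. elem_tensor \<zeta> a \<xi>)" "linear (\<lambda>\<xi>. elem_tensor \<zeta> a \<xi>)"
  by (rule linearI; simp add: elem_tensor_def fun_eq_iff scaleR_fun_def blinfun.bilinear_simps inner_simps algebra_simps)+

lemmas elem_tensor_simps =
  elem_tensor_linear(1)[THEN linear_add] elem_tensor_linear(2)[THEN linear_add] elem_tensor_linear(3)[THEN linear_add]
  elem_tensor_linear(1)[THEN linear_scale] elem_tensor_linear(2)[THEN linear_scale] elem_tensor_linear(3)[THEN linear_scale]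
  elem_tensor_linear(1)[THEN linear_sum] elem_tensor_linear(2)[THEN linear_sum] elem_tensor_linear(3)[THEN linear_sum]
  elem_tensor_linear(1)[THEN linear_neg] elem_tensor_linear(2)[THEN linear_neg] elem_tensor_linear(3)[THEN linear_neg]
  elem_tensor_linear(1)[THEN linear_0] elem_tensor_linear(2)[THEN linear_0] elem_tensor_linear(3)[THEN linear_0]

lemma fst_tensor_apply:
  "fst (tensor n \<zeta> a \<xi>) x y = (\<Sum>i<n. \<Sum>j<n. (inner (\<zeta> i) x * inner (\<xi> j) y) *\<^sub>R a i j)"
proof -
  have s: "(\<Sum>i\<in>I. f i) x y = (\<Sum>i\<in>I. f i x y)" for I :: "nat set" and f :: "nat \<Rightarrow> 'a \<Rightarrow> 'a \<Rightarrow> ('a \<Rightarrow>\<^sub>L 'a)"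
    by (induction I rule: infinite_finite_induct) auto
  show ?thesis by (simp add: tensor_def fst_sum s elem_tensor_def)
qed

lemma snd_tensor: "snd (tensor n \<zeta> a \<xi>) = mat_form n a \<xi> \<zeta>"
  by (simp add: tensor_def snd_sum elem_tensor_def mat_form_def)

lemma tensor_scale:
  "tensor n (\<lambda>i. r *\<^sub>R \<zeta> i) a \<xi> = r *\<^sub>R tensor n \<zeta> a \<xi>"
  "tensor n \<zeta> a (\<lambda>i. r *\<^sub>R \<xi> i) = r *\<^sub>R tensor n \<zeta> a \<xi>"
  by (simp_all add: tensor_def elem_tensor_simps scaleR_sum_right)

lemma tensor_minus: "tensor n (\<lambda>i. - \<zeta> i) a \<xi> = - tensor n \<zeta> a \<xi>"
  by (simp add: tensor_def elem_tensor_simps sum_negf)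

text \<open>The matrix product \<open>P a Q\<^sup>T\<close>.\<close>
definition compress ::
  "nat \<Rightarrow> (nat \<Rightarrow> nat \<Rightarrow> real) \<Rightarrow> (nat \<Rightarrow> nat \<Rightarrow> real) \<Rightarrow> (nat \<Rightarrow> nat \<Rightarrow> 'v) \<Rightarrow> nat \<Rightarrow> nat \<Rightarrow> 'v::real_vector" where
  "compress n P Q a i j = (\<Sum>k<n. \<Sum>l<n. (P i k * Q j l) *\<^sub>R a k l)"

lemma sum_rotate: "(\<Sum>i\<in>A. \<Sum>j\<in>B. \<Sum>k\<in>C. h i j k) = (\<Sum>k\<in>C. \<Sum>i\<in>A. \<Sum>j\<in>B. h i j k)"
  by (rule trans[OF _ sum.swap]) (intro sum.cong refl sum.swap)

text \<open>Scalar matrices can be moved from the operators to the vectors.\<close>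
lemma tensor_compress:
  assumes "coeff_proj n P" "coeff_proj n Q"
  shows "tensor n \<zeta> (compress n P Q a) \<xi> =
    tensor n (\<lambda>k. \<Sum>i<n. P k i *\<^sub>R \<zeta> i) a (\<lambda>l. \<Sum>j<n. Q l j *\<^sub>R \<xi> j)"
proof -
  have sym: "P i k = P k i" "Q i k = Q k i" for i k
    using assms unfolding coeff_proj_def by blast+
  have "tensor n \<zeta> (compress n P Q a) \<xi> =
    (\<Sum>i<n. \<Sum>j<n. \<Sum>k<n. \<Sum>l<n. (P i k * Q j l) *\<^sub>R elem_tensor (\<zeta> i) (a k l) (\<xi> j))"
    by (simp add: tensor_def compress_def elem_tensor_simps)
  also have "\<dots> = (\<Sum>k<n. \<Sum>l<n. \<Sum>i<n. \<Sum>j<n. (P i k * Q j l) *\<^sub>R elem_tensor (\<zeta> i) (a k l) (\<xi> j))"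
    by (rule trans[OF sum_rotate]) (intro sum.cong refl sum_rotate)
  also have "\<dots> = (\<Sum>k<n. \<Sum>l<n. \<Sum>i<n. \<Sum>j<n. (P k i * Q l j) *\<^sub>R elem_tensor (\<zeta> i) (a k l) (\<xi> j))"
    by (intro sum.cong refl arg_cong2[where f = scaleR] arg_cong2[where f = "(*)"] sym)
  also have "\<dots> = (\<Sum>k<n. \<Sum>l<n. \<Sum>j<n. \<Sum>i<n. (Q l j * P k i) *\<^sub>R elem_tensor (\<zeta> i) (a k l) (\<xi> j))"
    unfolding mult.commute[of "P _ _"] by (intro sum.cong refl sum.swap)
  also have "\<dots> = tensor n (\<lambda>k. \<Sum>i<n. P k i *\<^sub>R \<zeta> i) a (\<lambda>l. \<Sum>j<n. Q l j *\<^sub>R \<xi> j)"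
    by (simp add: tensor_def elem_tensor_simps scaleR_sum_right)
  finally show ?thesis .
qed

definition block_diag :: "nat \<Rightarrow> (nat \<Rightarrow> nat \<Rightarrow> 'v) \<Rightarrow> (nat \<Rightarrow> nat \<Rightarrow> 'v) \<Rightarrow> nat \<Rightarrow> nat \<Rightarrow> 'v::zero" where
  "block_diag m a b i j = (if i < m \<and> j < m then a i j else if m \<le> i \<and> m \<le> j then b (i - m) (j - m) else 0)"

definition append_vec :: "nat \<Rightarrow> (nat \<Rightarrow> 'v) \<Rightarrow> (nat \<Rightarrow> 'v) \<Rightarrow> nat \<Rightarrow> 'v" where
  "append_vec m \<xi> \<zeta> i = (if i < m then \<xi> i else \<zeta> (i - m))"

lemma sum_lessThan_add: "(\<Sum>i<m + n. f i) = (\<Sum>i<m. f i) + (\<Sum>i<n. f (m + i))"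
  for f :: "nat \<Rightarrow> 'v::comm_monoid_add"
  by (induction n) (simp_all add: add.assoc)

lemma tensor_block_diag:
  "tensor (m + n) (append_vec m \<zeta> \<zeta>') (block_diag m a b) (append_vec m \<xi> \<xi>') = tensor m \<zeta> a \<xi> + tensor n \<zeta>' b \<xi>'"
  by (simp add: tensor_def sum_lessThan_add append_vec_def block_diag_def elem_tensor_simps)

lemma sqn_append_vec: "sqn (m + n) (append_vec m \<xi> \<zeta>) = sqn m \<xi> + sqn n \<zeta>"
  by (simp add: sum_lessThan_add append_vec_def)

section \<open>Matrix balls\<close>

text \<open>Axioms for the unit balls, over all matrix sizes, of a matrix seminorm that is dominated by the operator
  norm and agrees with it on matrices over \<open>X\<close>, in the form in which the extension theorem uses them:
  invariance under compressions by projections and under direct sums. A larger ball means a smaller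
  seminorm, and the union of a chain of balls is a ball.\<close>
definition matrix_ball ::
  "('h::chilbert_space \<Rightarrow>\<^sub>L 'h) set \<Rightarrow> (nat \<times> (nat \<Rightarrow> nat \<Rightarrow> ('h \<Rightarrow>\<^sub>L 'h))) set \<Rightarrow> bool" where
  "matrix_ball X K \<longleftrightarrow>
    (\<forall>n a. mat_norm n a \<le> 1 \<longrightarrow> (n, a) \<in> K) \<and>
    (\<forall>n a P Q. (n, a) \<in> K \<longrightarrow> coeff_proj n P \<longrightarrow> coeff_proj n Q \<longrightarrow> (n, compress n P Q a) \<in> K) \<and>
    (\<forall>m a n b. (m, a) \<in> K \<longrightarrow> (n, b) \<in> K \<longrightarrow> (m + n, block_diag m a b) \<in> K) \<and>
    (\<forall>n a. (n, a) \<in> K \<longrightarrow> (\<forall>i<n. \<forall>j<n. a i j \<in> X) \<longrightarrow> mat_norm n a \<le> 1)"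

lemma mat_norm_compress:
  assumes PQ: "coeff_proj n P" "coeff_proj n Q" and a: "mat_norm n a \<le> 1"
  shows "mat_norm n (compress n P Q a) \<le> 1"
  unfolding mat_norm_le_iff_form[OF zero_less_one]
proof (intro allI)
  fix \<xi> \<zeta> :: "nat \<Rightarrow> 'a"
  let ?\<xi> = "\<lambda>l. \<Sum>j<n. Q l j *\<^sub>R \<xi> j" and ?\<zeta> = "\<lambda>k. \<Sum>i<n. P k i *\<^sub>R \<zeta> i"
  have "mat_form n (compress n P Q a) \<xi> \<zeta> = mat_form n a ?\<xi> ?\<zeta>"
    unfolding snd_tensor[symmetric] tensor_compress[OF PQ] ..
  also have "\<dots> \<le> 1 * (sqn n ?\<xi> + sqn n ?\<zeta>) / 2"
    using a unfolding mat_norm_le_iff_form[OF zero_less_one] by blast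
  also have "\<dots> \<le> 1 * (sqn n \<xi> + sqn n \<zeta>) / 2"
    using coeff_proj_contraction[OF PQ(1), of \<zeta>] coeff_proj_contraction[OF PQ(2), of \<xi>] by simp
  finally show "mat_form n (compress n P Q a) \<xi> \<zeta> \<le> 1 * (sqn n \<xi> + sqn n \<zeta>) / 2" .
qed

lemma mat_norm_block_diag:
  assumes "mat_norm m a \<le> 1" "mat_norm n b \<le> 1"
  shows "mat_norm (m + n) (block_diag m a b) \<le> 1"
  unfolding mat_norm_le_iff_form[OF zero_less_one]
proof (intro allI)
  fix \<xi> \<zeta> :: "nat \<Rightarrow> 'a"
  have j: "v = append_vec m v (\<lambda>i. v (m + i))" for v :: "nat \<Rightarrow> 'a" by (simp add: append_vec_def fun_eq_iff)
  let ?\<xi> = "\<lambda>i. \<xi> (m + i)" and ?\<zeta> = "\<lambda>i. \<zeta> (m + i)"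
  have "mat_form (m + n) (block_diag m a b) \<xi> \<zeta> = snd (tensor (m + n) (append_vec m \<zeta> ?\<zeta>) (block_diag m a b) (append_vec m \<xi> ?\<xi>))"
    unfolding snd_tensor j[symmetric] ..
  also have "\<dots> = mat_form m a \<xi> \<zeta> + mat_form n b ?\<xi> ?\<zeta>"
    unfolding tensor_block_diag by (simp add: snd_tensor)
  also have "\<dots> \<le> 1 * (sqn m \<xi> + sqn m \<zeta>) / 2 + 1 * (sqn n ?\<xi> + sqn n ?\<zeta>) / 2"
    using assms unfolding mat_norm_le_iff_form[OF zero_less_one] by (intro add_mono) blast+
  also have "\<dots> = 1 * (sqn (m + n) \<xi> + sqn (m + n) \<zeta>) / 2"
    by (simp add: sum_lessThan_add field_simps)
  finally show "mat_form (m + n) (block_diag m a b) \<xi> \<zeta> \<le> 1 * (sqn (m + n) \<xi> + sqn (m + n) \<zeta>) / 2" .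
qed

lemma matrix_ballD:
  assumes "matrix_ball X K"
  shows "mat_norm n a \<le> 1 \<Longrightarrow> (n, a) \<in> K"
    "(n, a) \<in> K \<Longrightarrow> coeff_proj n P \<Longrightarrow> coeff_proj n Q \<Longrightarrow> (n, compress n P Q a) \<in> K"
    "(m, a) \<in> K \<Longrightarrow> (n, b) \<in> K \<Longrightarrow> (m + n, block_diag m a b) \<in> K"
    "(n, a) \<in> K \<Longrightarrow> (\<And>i j. i < n \<Longrightarrow> j < n \<Longrightarrow> a i j \<in> X) \<Longrightarrow> mat_norm n a \<le> 1"
  using assms unfolding matrix_ball_def by blast+

text \<open>The norm on \<open>H \<otimes> B(H) \<otimes> H\<close> that is defined by \<open>K\<close> restricts to the corresponding norm on
  \<open>H \<otimes> X \<otimes> H\<close>. Given a representation \<open>\<Sum> \<zeta>\<^sub>i \<otimes> a\<^sub>i\<^sub>j \<otimes> \<xi>\<^sub>j\<close> of a tensor with values in \<open>X\<close>, compress \<open>a\<close> by the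
  projections of \<open>coeff_proj_onto_range\<close>. The tensor does not change, and the entries of the compressed
  matrix are values of the tensor, so they lie in \<open>X\<close>.\<close>
lemma tensor_in_subspace_bound:
  assumes K: "matrix_ball X K" and X: "subspace X" and a: "(n, a) \<in> K"
    and val: "\<And>x y. fst (tensor n \<zeta> a \<xi>) x y \<in> X"
  shows "mat_form n a \<xi> \<zeta> \<le> (sqn n \<xi> + sqn n \<zeta>) / 2"
proof -
  obtain P x where P: "coeff_proj n P" "\<And>k i. P k i = inner (\<zeta> i) (x k)" "\<And>i. i < n \<Longrightarrow> (\<Sum>k<n. P i k *\<^sub>R \<zeta> k) = \<zeta> i"
    using coeff_proj_onto_range[of n \<zeta>] by blast
  obtain Q y where Q: "coeff_proj n Q" "\<And>k i. Q k i = inner (\<xi> i) (y k)" "\<And>i. i < n \<Longrightarrow> (\<Sum>k<n. Q i k *\<^sub>R \<xi> k) = \<xi> i"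
    using coeff_proj_onto_range[of n \<xi>] by blast
  let ?b = "compress n P Q a"
  have "?b k l = fst (tensor n \<zeta> a \<xi>) (x k) (y l)" for k l
    by (simp add: compress_def fst_tensor_apply P(2) Q(2))
  then have bX: "?b k l \<in> X" for k l using val by simp
  have "(n, ?b) \<in> K" using matrix_ballD(2)[OF K a P(1) Q(1)] .
  then have "mat_norm n ?b \<le> 1" using matrix_ballD(4)[OF K] bX by blast
  then have "mat_form n ?b \<xi> \<zeta> \<le> (sqn n \<xi> + sqn n \<zeta>) / 2"
    unfolding mat_norm_le_iff_form[OF zero_less_one] by simp
  moreover have "tensor n \<zeta> ?b \<xi> = tensor n \<zeta> a \<xi>"
    unfolding tensor_compress[OF P(1) Q(1)] unfolding tensor_def
    by (intro sum.cong refl) (simp add: P(3) Q(3))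
  ultimately show ?thesis unfolding snd_tensor[symmetric] by simp
qed

text \<open>Extension theorem of Arveson and Wittstock. Such a map \<open>\<phi>\<close> is the same as a functional \<open>g\<close> on
  tensors, \<open>g (\<zeta> \<otimes> a \<otimes> \<xi>) = inner (\<phi> a \<xi>) \<zeta>\<close>. The requirements on \<open>\<phi>\<close> are that \<open>g\<close> coincides with \<open>snd\<close> on
  \<open>H \<otimes> X \<otimes> H\<close> and that \<open>g\<close> is at most \<open>(\<bar>\<xi>\<bar>\<^sup>2 + \<bar>\<zeta>\<bar>\<^sup>2) / 2\<close> on the tensor formed from \<open>\<zeta>\<close>, \<open>\<xi>\<close> and a matrix in \<open>K\<close>. They are
  consistent by \<open>tensor_in_subspace_bound\<close>.\<close>
theorem extension_dominated_by_ball: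
  fixes X :: "('h::chilbert_space \<Rightarrow>\<^sub>L 'h) set"
  assumes K: "matrix_ball X K" and X: "subspace X"
  shows "\<exists>\<phi>. linear \<phi> \<and> (\<forall>x\<in>X. \<phi> x = x) \<and>
    (\<forall>n a. (n, a) \<in> K \<longrightarrow> mat_norm n (\<lambda>i j. \<phi> (a i j)) \<le> 1)"
proof -
  define S where "S = span {elem_tensor \<zeta> x \<xi> |\<zeta> x \<xi>. x \<in> X}"
  \<comment> \<open>The cone of all inequalities \<open>g t \<le> r\<close> that follow from the requirements on \<open>g\<close>.\<close>
  define G where "G = {(s + tensor n \<zeta> a \<xi>, r) |s n \<zeta> a \<xi> r.
     s \<in> S \<and> (n, a) \<in> K \<and> snd s + (sqn n \<xi> + sqn n \<zeta>) / 2 \<le> r}"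
  have GI: "(s + tensor n \<zeta> a \<xi>, r) \<in> G"
    if "s \<in> S" "(n, a) \<in> K" "snd s + (sqn n \<xi> + sqn n \<zeta>) / 2 \<le> r" for s n \<zeta> a \<xi> r
    using that unfolding G_def by blast
  have S_sub: "subspace S" unfolding S_def by (rule subspace_span)
  have S_val: "fst s x y \<in> X" if "s \<in> S" for s x y
    using that unfolding S_def
  proof (induction rule: span_induct_alt)
    case base
    then show ?case using X by (simp add: subspace_0)
  next
    case (step c v w)
    then show ?case
      using X by (auto simp: scaleR_fun_def elem_tensor_def intro!: subspace_add subspace_scale)
  qed
  have K0: "(0, \<lambda>i j. 0) \<in> K"
    by (rule matrix_ballD(1)[OF K], rule mat_norm_le) auto
  have G_add: "(t + t', q + q') \<in> G" if "(t, q) \<in> G" "(t', q') \<in> G" for t t' q q'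
  proof -
    from that obtain s n \<zeta> a \<xi> s' n' \<zeta>' a' \<xi>' where
      1: "t = s + tensor n \<zeta> a \<xi>" "s \<in> S" "(n, a) \<in> K" "snd s + (sqn n \<xi> + sqn n \<zeta>) / 2 \<le> q" and
      2: "t' = s' + tensor n' \<zeta>' a' \<xi>'" "s' \<in> S" "(n', a') \<in> K" "snd s' + (sqn n' \<xi>' + sqn n' \<zeta>') / 2 \<le> q'"
      unfolding G_def by blast
    have "((s + s') + tensor (n + n') (append_vec n \<zeta> \<zeta>') (block_diag n a a') (append_vec n \<xi> \<xi>'), q + q') \<in> G"
      by (rule GI[OF subspace_add[OF S_sub 1(2) 2(2)] matrix_ballD(3)[OF K 1(3) 2(3)]])
        (use 1(4) 2(4) in \<open>simp add: sqn_append_vec add_divide_distrib\<close>)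
    then show ?thesis unfolding tensor_block_diag 1(1) 2(1) by (simp only: ac_simps)
  qed
  have "\<exists>g. (\<forall>(t, q)\<in>G. g t \<le> q) \<and>
    (\<forall>s\<in>fst ` G. \<forall>t\<in>fst ` G. g (s + t) = g s + g t) \<and>
    (\<forall>t\<in>fst ` G. \<forall>c. g (c *\<^sub>R t) = c * g t)"
  proof (rule dominated_functional)
    show "(0, 0) \<in> G"
      using GI[OF subspace_0[OF S_sub] K0, of "\<lambda>_. 0" "\<lambda>_. 0" 0] by (simp add: tensor_def)
  next
    show "(t + t', q + q') \<in> G" if "(t, q) \<in> G" "(t', q') \<in> G" for t t' q q'
      using that by (rule G_add)
  next
    fix t q and c :: real assume "(t, q) \<in> G" and c: "0 \<le> c"
    then obtain s n \<zeta> a \<xi> where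
      1: "t = s + tensor n \<zeta> a \<xi>" "s \<in> S" "(n, a) \<in> K" "snd s + (sqn n \<xi> + sqn n \<zeta>) / 2 \<le> q"
      unfolding G_def by blast
    \<comment> \<open>The cone is scaled by scaling both vectors by the square root, so that the matrix stays in \<open>K\<close>.\<close>
    have sq: "sqn n (\<lambda>i. sqrt c *\<^sub>R v i) = c * sqn n v" for v :: "nat \<Rightarrow> 'h"
      using c by (simp add: power_mult_distrib sum_distrib_left)
    have "c * (snd s + (sqn n \<xi> + sqn n \<zeta>) / 2) \<le> c * q" using 1(4) c by (rule mult_left_mono)
    then have "(c *\<^sub>R s + tensor n (\<lambda>i. sqrt c *\<^sub>R \<zeta> i) a (\<lambda>i. sqrt c *\<^sub>R \<xi> i), c * q) \<in> G"
      by (intro GI subspace_scale S_sub 1) (simp only: sq snd_scaleR real_scaleR_def distrib_left times_divide_eq_right)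
    then show "(c *\<^sub>R t, c * q) \<in> G" using c by (simp add: 1(1) tensor_scale scaleR_add_right)
  next
    fix t q r assume "(t, q) \<in> G" "q \<le> r"
    then show "(t, r) \<in> G" unfolding G_def by force
  next
    fix t q assume "(t, q) \<in> G"
    then obtain s n \<zeta> a \<xi> where
      1: "t = s + tensor n \<zeta> a \<xi>" "s \<in> S" "(n, a) \<in> K" unfolding G_def by blast
    have "(- s + tensor n (\<lambda>i. - \<zeta> i) a \<xi>, snd (- s) + (sqn n \<xi> + sqn n (\<lambda>i. - \<zeta> i)) / 2) \<in> G"
      by (intro GI subspace_neg S_sub 1) simp
    then show "\<exists>r. (- t, r) \<in> G" unfolding 1(1) tensor_minus by auto
  next
    fix q assume "(0, q) \<in> G"
    then obtain s n \<zeta> a \<xi> where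
      1: "0 = s + tensor n \<zeta> a \<xi>" "s \<in> S" "(n, a) \<in> K" "snd s + (sqn n \<xi> + sqn n \<zeta>) / 2 \<le> q"
      unfolding G_def by blast
    \<comment> \<open>This tensor equals one over \<open>X\<close>, so its norm is computed over \<open>X\<close>.\<close>
    have t: "tensor n \<zeta> a \<xi> = - s" using 1(1) by (metis minus_unique add.inverse_inverse)
    have "fst (tensor n \<zeta> a \<xi>) x y \<in> X" for x y
      unfolding t by (rule S_val) (intro subspace_neg S_sub 1)
    then have "mat_form n a \<xi> \<zeta> \<le> (sqn n \<xi> + sqn n \<zeta>) / 2"
      by (rule tensor_in_subspace_bound[OF K X 1(3)])
    moreover have "mat_form n a \<xi> \<zeta> = - snd s" unfolding snd_tensor[symmetric] t by simp
    ultimately show "0 \<le> q" using 1(4) by linarith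
  qed
  then obtain g where g: "\<forall>(t, q)\<in>G. g t \<le> q" "\<forall>s\<in>fst ` G. \<forall>t\<in>fst ` G. g (s + t) = g s + g t"
    "\<forall>t\<in>fst ` G. \<forall>c. g (c *\<^sub>R t) = c * g t" by (elim exE conjE)
  have g_le: "\<And>t q. (t, q) \<in> G \<Longrightarrow> g t \<le> q"
    and g_add: "\<And>s t. s \<in> fst ` G \<Longrightarrow> t \<in> fst ` G \<Longrightarrow> g (s + t) = g s + g t"
    and g_scale: "\<And>t c. t \<in> fst ` G \<Longrightarrow> g (c *\<^sub>R t) = c * g t"
    using g by blast+
  have D_tensor: "tensor n \<zeta> a \<xi> \<in> fst ` G" if "(n, a) \<in> K" for n \<zeta> a \<xi>
    using GI[OF subspace_0[OF S_sub] that order_refl] by force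
  \<comment> \<open>Some multiple of \<open>a\<close> lies in the ball, and the inverse factor is absorbed into \<open>\<xi>\<close>.\<close>
  have D_elem: "elem_tensor \<zeta> a \<xi> \<in> fst ` G" for \<zeta> a \<xi>
  proof -
    define c where "c = norm a + 1"
    have c: "c > 0" by (simp add: c_def add_nonneg_pos)
    have "mat_norm 1 (\<lambda>i j. (1/c) *\<^sub>R a) \<le> 1"
      unfolding mat_norm_one using c by (simp add: c_def)
    then have "tensor 1 (\<lambda>_. \<zeta>) (\<lambda>i j. (1/c) *\<^sub>R a) (\<lambda>_. c *\<^sub>R \<xi>) \<in> fst ` G"
      by (intro D_tensor matrix_ballD(1)[OF K])
    then show ?thesis using c by (simp add: tensor_def elem_tensor_simps)
  qed
  have g_S: "g s = snd s" if "s \<in> S" for s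
  proof -
    have G: "(s, snd s) \<in> G" if "s \<in> S" for s
      using GI[OF that K0, of "\<lambda>_. 0" "\<lambda>_. 0"] by (simp add: tensor_def)
    have D: "s \<in> fst ` G" using G[OF that] by force
    have "g s \<le> snd s" using g_le[OF G[OF that]] .
    moreover have "- g s \<le> - snd s"
      using g_le[OF G[OF subspace_neg[OF S_sub that]]] g_scale[OF D, of "-1"] by simp
    ultimately show ?thesis by simp
  qed
  have bil: "bounded_bilinear (\<lambda>\<zeta> \<xi>. g (elem_tensor \<zeta> a \<xi>))" for a
  proof
    show "g (elem_tensor (\<zeta> + \<zeta>') a \<xi>) = g (elem_tensor \<zeta> a \<xi>) + g (elem_tensor \<zeta>' a \<xi>)" for \<zeta> \<zeta>' \<xi>
      by (simp add: elem_tensor_simps g_add D_elem)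
    show "g (elem_tensor \<zeta> a (\<xi> + \<xi>')) = g (elem_tensor \<zeta> a \<xi>) + g (elem_tensor \<zeta> a \<xi>')" for \<zeta> \<xi> \<xi>'
      by (simp add: elem_tensor_simps g_add D_elem)
    show s1: "g (elem_tensor (r *\<^sub>R \<zeta>) a \<xi>) = r *\<^sub>R g (elem_tensor \<zeta> a \<xi>)" for r \<zeta> \<xi>
      by (simp add: elem_tensor_simps g_scale D_elem)
    show s2: "g (elem_tensor \<zeta> a (r *\<^sub>R \<xi>)) = r *\<^sub>R g (elem_tensor \<zeta> a \<xi>)" for r \<zeta> \<xi>
      by (simp add: elem_tensor_simps g_scale D_elem)
    define c where "c = norm a + 1"
    have c: "c > 0" by (simp add: c_def add_nonneg_pos)
    have unit: "g (elem_tensor \<zeta> a \<xi>) \<le> c" if "norm \<zeta> = 1" "norm \<xi> = 1" for \<zeta> \<xi>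
    proof -
      have "mat_norm 1 (\<lambda>i j. (1/c) *\<^sub>R a) \<le> 1"
        unfolding mat_norm_one using c by (simp add: c_def)
      from g_le[OF GI[OF subspace_0[OF S_sub] matrix_ballD(1)[OF K this] order_refl, of "\<lambda>_. \<zeta>" "\<lambda>_. \<xi>"]]
      have "g (elem_tensor \<zeta> ((1/c) *\<^sub>R a) \<xi>) \<le> 1"
        using that by (simp add: tensor_def)
      then show ?thesis using c by (simp add: elem_tensor_simps g_scale D_elem field_simps)
    qed
    show "\<exists>K. \<forall>\<zeta> \<xi>. norm (g (elem_tensor \<zeta> a \<xi>)) \<le> norm \<zeta> * norm \<xi> * K"
    proof (intro exI allI)
      fix \<zeta> \<xi> :: 'h
      have le: "g (elem_tensor \<zeta> a \<xi>) \<le> norm \<zeta> * norm \<xi> * c" for \<zeta> \<xi>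
      proof (cases "\<zeta> = 0 \<or> \<xi> = 0")
        case True
        then show ?thesis using s1[of 0 0 \<xi>] s2[of \<zeta> 0 0] by auto
      next
        case False
        then have "g (elem_tensor ((1/norm \<zeta>) *\<^sub>R \<zeta>) a ((1/norm \<xi>) *\<^sub>R \<xi>)) \<le> c" by (intro unit) auto
        then show ?thesis using False unfolding s1 s2 by (simp add: field_simps)
      qed
      show "norm (g (elem_tensor \<zeta> a \<xi>)) \<le> norm \<zeta> * norm \<xi> * c"
        using le[of \<zeta> \<xi>] le[of "(-1) *\<^sub>R \<zeta>" \<xi>] unfolding s1 by (simp add: abs_le_iff)
    qed
  qed
  obtain \<phi> where \<phi>: "\<And>a \<zeta> \<xi>. inner (blinfun_apply (\<phi> a) \<xi>) \<zeta> = g (elem_tensor \<zeta> a \<xi>)"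
    using operator_of_form[OF bil] by metis
  have "linear \<phi>"
    by (rule linearI; rule blinfun_eq_by_inner)
      (simp_all add: \<phi> elem_tensor_simps g_add g_scale D_elem blinfun.bilinear_simps inner_simps)
  moreover have "\<phi> x = x" if "x \<in> X" for x
  proof (rule blinfun_eq_by_inner)
    fix \<zeta> \<xi>
    have "elem_tensor \<zeta> x \<xi> \<in> S" unfolding S_def using that by (intro span_base) blast
    then show "inner (blinfun_apply (\<phi> x) \<xi>) \<zeta> = inner (blinfun_apply x \<xi>) \<zeta>"
      by (simp add: \<phi> g_S) (simp add: elem_tensor_def)
  qed
  moreover have "mat_norm n (\<lambda>i j. \<phi> (a i j)) \<le> 1" if a: "(n, a) \<in> K" for n a
    unfolding mat_norm_le_iff_form[OF zero_less_one]
  proof (intro allI)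
    fix \<xi> \<zeta>
    have D0: "0 \<in> fst ` G" using g_S GI[OF subspace_0[OF S_sub] K0, of "\<lambda>_. 0" "\<lambda>_. 0"] by (force simp: tensor_def)
    have g_sum: "g (\<Sum>i\<in>I. f i) = (\<Sum>i\<in>I. g (f i)) \<and> (\<Sum>i\<in>I. f i) \<in> fst ` G"
      if "finite I" "\<And>i. i \<in> I \<Longrightarrow> f i \<in> fst ` G" for I :: "nat set" and f
      using that
    proof (induction I rule: finite_induct)
      case empty
      then show ?case using D0 g_scale[OF D0, of 0] by simp
    next
      case (insert i I)
      have "s + t \<in> fst ` G" if "s \<in> fst ` G" "t \<in> fst ` G" for s t
        using that G_add by force
      then show ?case using insert by (auto simp: g_add)
    qed
    have "mat_form n (\<lambda>i j. \<phi> (a i j)) \<xi> \<zeta> = (\<Sum>i<n. \<Sum>j<n. g (elem_tensor (\<zeta> i) (a i j) (\<xi> j)))"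
      by (simp add: mat_form_def \<phi>)
    also have "\<dots> = g (tensor n \<zeta> a \<xi>)"
      unfolding tensor_def using g_sum D_elem by simp
    also have "\<dots> \<le> (sqn n \<xi> + sqn n \<zeta>) / 2"
      using g_le[OF GI[OF subspace_0[OF S_sub] a order_refl]] by simp
    finally show "mat_form n (\<lambda>i j. \<phi> (a i j)) \<xi> \<zeta> \<le> 1 * (sqn n \<xi> + sqn n \<zeta>) / 2" by simp
  qed
  ultimately show ?thesis by blast
qed

section \<open>Complete contractions fixing a unital space\<close>

definition fixing :: "('h::chilbert_space \<Rightarrow>\<^sub>L 'h) set \<Rightarrow> (('h \<Rightarrow>\<^sub>L 'h) \<Rightarrow> ('h \<Rightarrow>\<^sub>L 'h)) \<Rightarrow> bool" where
  "fixing X \<phi> \<longleftrightarrow> linear \<phi> \<and> (\<forall>x\<in>X. \<phi> x = x) \<and>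
    (\<forall>n a. mat_norm n (\<lambda>i j. \<phi> (a i j)) \<le> mat_norm n a)"

lemma fixingD:
  assumes "fixing X \<phi>"
  shows "linear \<phi>" "x \<in> X \<Longrightarrow> \<phi> x = x" "mat_norm n (\<lambda>i j. \<phi> (a i j)) \<le> mat_norm n a"
  using assms unfolding fixing_def by blast+

lemma fixing_norm: "fixing X \<phi> \<Longrightarrow> norm (\<phi> T) \<le> norm T"
  using fixingD(3)[of X \<phi> 1 "\<lambda>i j. T"] unfolding mat_norm_one .

lemma fixing_bounded_linear:
  assumes "fixing X \<phi>"
  shows "bounded_linear \<phi>"
  using fixingD(1)[OF assms] fixing_norm[OF assms]
  by (intro bounded_linear_intro[where K = 1]) (auto simp: linear_add linear_scale)

lemma fixing_comp:
  assumes \<phi>: "fixing X \<phi>" and \<psi>: "fixing X \<psi>"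
  shows "fixing X (\<phi> \<circ> \<psi>)"
  unfolding fixing_def
proof (intro conjI ballI allI)
  show "linear (\<phi> \<circ> \<psi>)" using \<phi> \<psi> by (intro linear_compose fixingD(1))
  show "mat_norm n (\<lambda>i j. (\<phi> \<circ> \<psi>) (a i j)) \<le> mat_norm n a" for n a
    using fixingD(3)[OF \<phi>, of n "\<lambda>i j. \<psi> (a i j)"] fixingD(3)[OF \<psi>, of n a] by simp
qed (simp add: fixingD(2)[OF \<phi>] fixingD(2)[OF \<psi>])

lemma fixing_id: "fixing X id"
  unfolding fixing_def by (simp add: linear_id)

lemma extension_fixing:
  assumes K: "matrix_ball X K" and X: "subspace X"
  shows "\<exists>\<phi>. fixing X \<phi> \<and> (\<forall>n a. (n, a) \<in> K \<longrightarrow> mat_norm n (\<lambda>i j. \<phi> (a i j)) \<le> 1)"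
proof -
  obtain \<phi> where \<phi>: "linear \<phi>" "\<forall>x\<in>X. \<phi> x = x"
    "\<And>n a. (n, a) \<in> K \<Longrightarrow> mat_norm n (\<lambda>i j. \<phi> (a i j)) \<le> 1"
    using extension_dominated_by_ball[OF K X] by blast
  have "mat_norm n (\<lambda>i j. \<phi> (a i j)) \<le> mat_norm n a" for n a
  proof (rule dense_ge)
    fix c assume c: "mat_norm n a < c"
    then have "c > 0" using mat_norm_nonneg[of n a] by linarith
    have "mat_norm n (\<lambda>i j. (1/c) *\<^sub>R a i j) \<le> 1"
      unfolding mat_norm_scale using c \<open>c > 0\<close> by simp
    then have "mat_norm n (\<lambda>i j. \<phi> ((1/c) *\<^sub>R a i j)) \<le> 1"
      by (intro \<phi>(3) matrix_ballD(1)[OF K])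
    then show "mat_norm n (\<lambda>i j. \<phi> (a i j)) \<le> c"
      unfolding linear_scale[OF \<phi>(1)] mat_norm_scale using \<open>c > 0\<close> by (simp add: field_simps)
  qed
  then show ?thesis using \<phi> unfolding fixing_def by blast
qed

text \<open>Positivity of the quadratic form, without any symmetry of the matrix. If both \<open>a\<close> and \<open>- a\<close> are accretive
  then \<open>a\<close> is skew-adjoint.\<close>
definition accretive :: "nat \<Rightarrow> (nat \<Rightarrow> nat \<Rightarrow> ('a::real_inner \<Rightarrow>\<^sub>L 'a)) \<Rightarrow> bool" where
  "accretive n a \<longleftrightarrow> (\<forall>\<xi>. 0 \<le> mat_form n a \<xi> \<xi>)"

text \<open>Complete positivity of a unital complete contraction, derived from the norm: \<open>a\<close> is accretive
  exactly if \<open>\<parallel>1 - s a\<parallel>\<^sup>2 \<le> 1 + O(s\<^sup>2)\<close> as \<open>s\<close> decreases to \<open>0\<close>, and \<open>\<phi>\<close> preserves this estimate.\<close>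
lemma fixing_accretive:
  fixes X :: "('h::chilbert_space \<Rightarrow>\<^sub>L 'h) set"
  assumes \<phi>: "fixing X \<phi>" and one: "id_blinfun \<in> X" and acc: "accretive n a"
  shows "accretive n (\<lambda>i j. \<phi> (a i j))"
  unfolding accretive_def
proof
  fix \<xi> :: "nat \<Rightarrow> 'h"
  define c where "c = mat_norm n a"
  define b where "b s i j = (if i = j then id_blinfun else 0) - s *\<^sub>R a i j" for s i j
  have app: "mat_apply n (\<lambda>i j. (if i = j then id_blinfun else 0) - s *\<^sub>R d i j) \<zeta> i
      = \<zeta> i - s *\<^sub>R mat_apply n d \<zeta> i" if "i < n" for s \<zeta> i and d :: "nat \<Rightarrow> nat \<Rightarrow> ('h \<Rightarrow>\<^sub>L 'h)"
  proof -
    have "blinfun_apply (if i = j then id_blinfun else 0) (\<zeta> j) = (if i = j then \<zeta> j else 0)" for j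
      by simp
    then show ?thesis using that
      by (simp add: blinfun.bilinear_simps sum_subtractf scaleR_sum_right)
  qed
  have sq: "sqn n (mat_apply n (\<lambda>i j. (if i = j then id_blinfun else 0) - s *\<^sub>R d i j) \<zeta>)
      = sqn n \<zeta> - 2 * s * mat_form n d \<zeta> \<zeta> + s\<^sup>2 * sqn n (mat_apply n d \<zeta>)"
    for s \<zeta> and d :: "nat \<Rightarrow> nat \<Rightarrow> ('h \<Rightarrow>\<^sub>L 'h)"
  proof -
    have "(norm (\<zeta> i - s *\<^sub>R v))\<^sup>2 = (norm (\<zeta> i))\<^sup>2 - 2 * s * inner v (\<zeta> i) + s\<^sup>2 * (norm v)\<^sup>2" for i v
      unfolding power2_norm_eq_inner
      by (simp add: inner_diff_left inner_diff_right inner_commute power2_eq_square)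
    then show ?thesis
      by (simp add: app mat_form_apply sum.distrib sum_subtractf sum_distrib_left mult.assoc)
  qed
  have bnorm: "(mat_norm n (b s))\<^sup>2 \<le> 1 + s\<^sup>2 * c\<^sup>2" if "s > 0" for s
  proof -
    have "mat_norm n (b s) \<le> sqrt (1 + s\<^sup>2 * c\<^sup>2)"
    proof (rule mat_norm_le)
      fix \<zeta>
      have "sqn n (mat_apply n (b s) \<zeta>) = sqn n \<zeta> - 2 * s * mat_form n a \<zeta> \<zeta> + s\<^sup>2 * sqn n (mat_apply n a \<zeta>)"
        unfolding b_def by (rule sq)
      also have "\<dots> \<le> sqn n \<zeta> - 0 + s\<^sup>2 * (c\<^sup>2 * sqn n \<zeta>)"
        using acc \<open>s > 0\<close> mat_norm_bound[of a \<zeta> n] unfolding accretive_def c_def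
        by (intro add_mono diff_mono mult_left_mono) auto
      finally show "sqn n (mat_apply n (b s) \<zeta>) \<le> (sqrt (1 + s\<^sup>2 * c\<^sup>2))\<^sup>2 * sqn n \<zeta>"
        by (simp add: add_nonneg_nonneg algebra_simps)
    qed simp
    from power_mono[OF this mat_norm_nonneg, of 2] show ?thesis by (simp add: add_nonneg_nonneg)
  qed
  let ?f = "mat_form n (\<lambda>i j. \<phi> (a i j)) \<xi> \<xi>"
  have ineq: "- ?f \<le> s * (c\<^sup>2 * sqn n \<xi> / 2)" if s: "s > 0" for s
  proof -
    have \<phi>b: "\<phi> (b s i j) = (if i = j then id_blinfun else 0) - s *\<^sub>R \<phi> (a i j)" for i j
      using fixingD(2)[OF \<phi> one] fixingD(1)[OF \<phi>] by (simp add: b_def linear_diff linear_scale linear_0)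
    have "sqn n \<xi> - 2 * s * ?f + s\<^sup>2 * sqn n (mat_apply n (\<lambda>i j. \<phi> (a i j)) \<xi>)
        = sqn n (mat_apply n (\<lambda>i j. \<phi> (b s i j)) \<xi>)"
      unfolding \<phi>b sq ..
    also have "\<dots> \<le> (mat_norm n (\<lambda>i j. \<phi> (b s i j)))\<^sup>2 * sqn n \<xi>" by (rule mat_norm_bound)
    also have "\<dots> \<le> (mat_norm n (b s))\<^sup>2 * sqn n \<xi>"
      using fixingD(3)[OF \<phi>] mat_norm_nonneg sqn_nonneg by (intro mult_right_mono power_mono) blast+
    also have "\<dots> \<le> (1 + s\<^sup>2 * c\<^sup>2) * sqn n \<xi>" using bnorm[OF s] sqn_nonneg by (intro mult_right_mono)
    finally have "sqn n \<xi> - 2 * s * ?f \<le> (1 + s\<^sup>2 * c\<^sup>2) * sqn n \<xi>"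
      using mult_nonneg_nonneg[OF zero_le_power2[of s] sqn_nonneg[of "mat_apply n (\<lambda>i j. \<phi> (a i j)) \<xi>" n]]
      by linarith
    then have "s * (- ?f) \<le> s * (s * (c\<^sup>2 * sqn n \<xi> / 2))" by (simp add: algebra_simps power2_eq_square)
    then show ?thesis using s by (rule mult_left_le_imp_le)
  qed
  have "- ?f \<le> 0"
  proof (rule tendsto_lowerbound)
    show "((\<lambda>s. s * (c\<^sup>2 * sqn n \<xi> / 2)) \<longlongrightarrow> 0) (at_right 0)"
      by (rule tendsto_mult_left_zero[OF tendsto_ident_at])
    show "\<forall>\<^sub>F s in at_right 0. - ?f \<le> s * (c\<^sup>2 * sqn n \<xi> / 2)"
      using ineq eventually_at_right_less by (rule eventually_mono[rotated])
  qed simp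
  then show "0 \<le> ?f" by simp
qed

lemma mat_form_2:
  "mat_form 2 a \<xi> \<zeta> =
    inner (blinfun_apply (a 0 0) (\<xi> 0)) (\<zeta> 0) + inner (blinfun_apply (a 0 1) (\<xi> 1)) (\<zeta> 0) +
    inner (blinfun_apply (a 1 0) (\<xi> 0)) (\<zeta> 1) + inner (blinfun_apply (a 1 1) (\<xi> 1)) (\<zeta> 1)"
  by (simp add: mat_form_def numeral_2_eq_2)

text \<open>Over real scalars contractivity on \<open>B(H)\<close> itself does not suffice for this; two-by-two
  matrices are used. The matrix with off-diagonal entries \<open>S\<close> and \<open>- adj S\<close> is skew-adjoint, so it and its
  negative are accretive, and its image is skew-adjoint as well.\<close>
lemma fixing_adj:
  assumes \<phi>: "fixing X \<phi>" and one: "id_blinfun \<in> X"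
  shows "\<phi> (adj T) = adj (\<phi> T)"
proof -
  note lin = fixingD(1)[OF \<phi>]
  have le: "inner (blinfun_apply (\<phi> (adj S)) x) y \<le> inner (blinfun_apply (\<phi> S) y) x" for x y S
  proof -
    define a where "a i j = (if i = 0 \<and> j = 1 then S else if i = 1 \<and> j = 0 then - adj S else 0)" for i j :: nat
    have "accretive 2 a"
      unfolding accretive_def mat_form_2
      by (simp add: a_def blinfun.bilinear_simps inner_adj) (simp add: inner_commute)
    then have "accretive 2 (\<lambda>i j. \<phi> (a i j))" by (rule fixing_accretive[OF \<phi> one])
    then have "0 \<le> mat_form 2 (\<lambda>i j. \<phi> (a i j)) (\<lambda>i. if i = 0 then x else y) (\<lambda>i. if i = 0 then x else y)"
      unfolding accretive_def by blast
    then show ?thesis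
      unfolding mat_form_2 by (simp add: a_def linear_0[OF lin] linear_neg[OF lin] blinfun.bilinear_simps)
  qed
  have "inner (blinfun_apply (\<phi> (adj T)) x) y = inner (blinfun_apply (\<phi> T) y) x" for x y
    using le[of T x y] le[of "adj T" y x] by (simp add: adj_simps)
  then show ?thesis by (intro adj_eqI[symmetric]) (simp add: inner_commute)
qed

lemma mat_form_gram:
  "mat_form n (\<lambda>i j. adj (b i) o\<^sub>L b j) \<xi> \<xi> =
    inner (\<Sum>j<n. blinfun_apply (b j) (\<xi> j)) (\<Sum>j<n. blinfun_apply (b j) (\<xi> j))"
  by (subst inner_sum_right) (simp add: mat_form_def inner_adj inner_sum_left)

text \<open>The Gram matrix of \<open>1, b 0, ..., b (n - 1)\<close> is accretive, hence so is its image under \<open>\<phi>\<close>. Minimizing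
  the quadratic form of the image over the vector in the position of \<open>1\<close> gives the Schur complement.\<close>
lemma kadison_schwarz:
  fixes X :: "('h::chilbert_space \<Rightarrow>\<^sub>L 'h) set" and b :: "nat \<Rightarrow> ('h \<Rightarrow>\<^sub>L 'h)"
  assumes \<phi>: "fixing X \<phi>" and one: "id_blinfun \<in> X"
  shows "accretive n (\<lambda>i j. \<phi> (adj (b i) o\<^sub>L b j) - (adj (\<phi> (b i)) o\<^sub>L \<phi> (b j)))"
  unfolding accretive_def
proof
  fix \<xi> :: "nat \<Rightarrow> 'h"
  define B where "B = case_nat id_blinfun b"
  have "accretive (Suc n) (\<lambda>i j. adj (B i) o\<^sub>L B j)"
    unfolding accretive_def
    by (simp add: mat_form_gram del: sum.lessThan_Suc)
  then have acc: "accretive (Suc n) (\<lambda>i j. \<phi> (adj (B i) o\<^sub>L B j))" by (rule fixing_accretive[OF \<phi> one])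
  define v where "v = (\<Sum>j<n. blinfun_apply (\<phi> (b j)) (\<xi> j))"
  let ?S = "mat_form n (\<lambda>i j. \<phi> (adj (b i) o\<^sub>L b j)) \<xi> \<xi>"
  have [simp]: "id_blinfun o\<^sub>L T = T" "T o\<^sub>L id_blinfun = T" for T :: "'h \<Rightarrow>\<^sub>L 'h"
    by (rule blinfun_eqI, simp)+
  \<comment> \<open>The minimum over the zeroth vector is attained at \<open>- v\<close>.\<close>
  have "0 \<le> mat_form (Suc n) (\<lambda>i j. \<phi> (adj (B i) o\<^sub>L B j)) (case_nat (- v) \<xi>) (case_nat (- v) \<xi>)"
    using acc unfolding accretive_def by blast
  also have "\<dots> = inner (- v) (- v) + (\<Sum>j<n. inner (blinfun_apply (\<phi> (b j)) (\<xi> j)) (- v))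
      + (\<Sum>i<n. inner (- v) (blinfun_apply (\<phi> (b i)) (\<xi> i))) + ?S"
    unfolding mat_form_def
    by (simp add: sum.lessThan_Suc_shift B_def adj_simps fixingD(2)[OF \<phi> one] sum.distrib
       fixing_adj[OF \<phi> one] inner_adj del: inner_minus_left inner_minus_right sum.lessThan_Suc)
  also have "\<dots> = ?S - inner v v"
    unfolding inner_sum_left[symmetric] inner_sum_right[symmetric] v_def[symmetric] by simp
  also have "inner v v = mat_form n (\<lambda>i j. adj (\<phi> (b i)) o\<^sub>L \<phi> (b j)) \<xi> \<xi>"
    unfolding mat_form_gram v_def ..
  finally show "0 \<le> mat_form n (\<lambda>i j. \<phi> (adj (b i) o\<^sub>L b j) - (adj (\<phi> (b i)) o\<^sub>L \<phi> (b j))) \<xi> \<xi>"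
    by (simp add: mat_form_def blinfun.bilinear_simps inner_diff_left sum_subtractf)
qed

section \<open>A minimal complete contraction\<close>

text \<open>A complete contraction \<open>\<phi>\<close> that fixes \<open>X\<close> defines the matrix seminorm \<open>\<parallel>\<phi> a\<parallel>\<close>.\<close>
lemma matrix_ball_fixing:
  assumes \<phi>: "fixing X \<phi>"
  shows "matrix_ball X {(n, a). mat_norm n (\<lambda>i j. \<phi> (a i j)) \<le> 1}"
  unfolding matrix_ball_def
proof (intro conjI allI impI; unfold mem_Collect_eq split_conv)
  note lin = fixingD(1)[OF \<phi>]
  show "mat_norm n (\<lambda>i j. \<phi> (a i j)) \<le> 1" if "mat_norm n a \<le> 1" for n a
    using fixingD(3)[OF \<phi>] that order_trans by blast
  show "mat_norm n (\<lambda>i j. \<phi> (compress n P Q a i j)) \<le> 1"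
    if "mat_norm n (\<lambda>i j. \<phi> (a i j)) \<le> 1" "coeff_proj n P" "coeff_proj n Q" for n a P Q
  proof -
    have "(\<lambda>i j. \<phi> (compress n P Q a i j)) = compress n P Q (\<lambda>i j. \<phi> (a i j))"
      by (simp add: compress_def fun_eq_iff linear_sum[OF lin] linear_scale[OF lin])
    then show ?thesis using mat_norm_compress[OF that(2,3,1)] by simp
  qed
  show "mat_norm (m + n) (\<lambda>i j. \<phi> (block_diag m a b i j)) \<le> 1"
    if "mat_norm m (\<lambda>i j. \<phi> (a i j)) \<le> 1" "mat_norm n (\<lambda>i j. \<phi> (b i j)) \<le> 1" for m a n b
  proof -
    have "(\<lambda>i j. \<phi> (block_diag m a b i j)) = block_diag m (\<lambda>i j. \<phi> (a i j)) (\<lambda>i j. \<phi> (b i j))"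
      by (simp add: block_diag_def fun_eq_iff linear_0[OF lin])
    then show ?thesis using mat_norm_block_diag[OF that] by simp
  qed
  show "mat_norm n a \<le> 1" if "mat_norm n (\<lambda>i j. \<phi> (a i j)) \<le> 1" "\<forall>i<n. \<forall>j<n. a i j \<in> X" for n a
  proof -
    have "mat_norm n (\<lambda>i j. \<phi> (a i j)) = mat_norm n a"
      by (rule mat_norm_cong) (use that(2) fixingD(2)[OF \<phi>] in blast)
    then show ?thesis using that(1) by simp
  qed
qed

lemma maximal_matrix_ball: "\<exists>K. matrix_ball X K \<and> (\<forall>L. matrix_ball X L \<longrightarrow> K \<subseteq> L \<longrightarrow> L = K)"
proof -
  have "\<exists>K\<in>Collect (matrix_ball X). \<forall>L\<in>Collect (matrix_ball X). K \<subseteq> L \<longrightarrow> L = K"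
  proof (rule subset_Zorn_nonempty)
    show "Collect (matrix_ball X) \<noteq> {}" using matrix_ball_fixing[OF fixing_id[of X]] by blast
    fix \<C> assume \<C>: "\<C> \<noteq> {}" "subset.chain (Collect (matrix_ball X)) \<C>"
    have ball: "matrix_ball X K" if "K \<in> \<C>" for K
      using \<C>(2) that unfolding subset.chain_def by blast
    show "\<Union>\<C> \<in> Collect (matrix_ball X)"
      unfolding mem_Collect_eq matrix_ball_def
    proof (intro conjI allI impI)
      show "(n, a) \<in> \<Union>\<C>" if "mat_norm n a \<le> 1" for n a
        using \<C>(1) matrix_ballD(1)[OF ball that] by blast
      show "(n, compress n P Q a) \<in> \<Union>\<C>" if "(n, a) \<in> \<Union>\<C>" "coeff_proj n P" "coeff_proj n Q" for n a P Q
        using that matrix_ballD(2)[OF ball] by blast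
      show "mat_norm n a \<le> 1" if "(n, a) \<in> \<Union>\<C>" "\<forall>i<n. \<forall>j<n. a i j \<in> X" for n a
        using that matrix_ballD(4)[OF ball] by blast
      show "(m + n, block_diag m a b) \<in> \<Union>\<C>" if ab: "(m, a) \<in> \<Union>\<C>" "(n, b) \<in> \<Union>\<C>" for m a n b
      proof -
        obtain K L where KL: "K \<in> \<C>" "L \<in> \<C>" "(m, a) \<in> K" "(n, b) \<in> L" using ab by blast
        then have "K \<subseteq> L \<or> L \<subseteq> K" using \<C>(2) unfolding subset.chain_def by blast
        then obtain M where "M \<in> \<C>" "(m, a) \<in> M" "(n, b) \<in> M" using KL by blast
        then show ?thesis using matrix_ballD(3)[OF ball] by blast
      qed
    qed
  qed
  then show ?thesis by blast
qed

text \<open>The averages start with the first power of \<open>\<theta>\<close>, so that \<open>\<parallel>\<theta> a\<parallel>\<close> bounds them.\<close>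
definition iter_avg :: "nat \<Rightarrow> ('v \<Rightarrow> 'v) \<Rightarrow> 'v \<Rightarrow> 'v::real_vector" where
  "iter_avg m \<theta> T = (1 / real m) *\<^sub>R (\<Sum>k<m. (\<theta> ^^ Suc k) T)"

lemma fixing_funpow: "fixing X \<theta> \<Longrightarrow> fixing X (\<theta> ^^ k)"
  by (induction k) (auto simp: fixing_id fixing_comp)

lemma mat_norm_iter_avg:
  assumes \<theta>: "fixing X \<theta>" and m: "m > 0"
  shows "mat_norm n (\<lambda>i j. iter_avg m \<theta> (a i j)) \<le> mat_norm n (\<lambda>i j. \<theta> (a i j))"
proof -
  let ?c = "mat_norm n (\<lambda>i j. \<theta> (a i j))"
  have "mat_norm n (\<lambda>i j. \<Sum>k<l. (\<theta> ^^ Suc k) (a i j)) \<le> real l * ?c" for l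
  proof (induction l)
    case 0
    show ?case using mat_norm_scale[of n 0 a] by simp
  next
    case (Suc l)
    have "mat_norm n (\<lambda>i j. (\<theta> ^^ Suc l) (a i j)) \<le> ?c"
      using fixingD(3)[OF fixing_funpow[OF \<theta>], of n l "\<lambda>i j. \<theta> (a i j)"] by (simp add: funpow_swap1)
    then show ?case
      using Suc mat_norm_add[of n "\<lambda>i j. \<Sum>k<l. (\<theta> ^^ Suc k) (a i j)" "\<lambda>i j. (\<theta> ^^ Suc l) (a i j)"]
      by (simp add: algebra_simps del: funpow.simps)
  qed
  from this[of m] show ?thesis
    using m unfolding iter_avg_def mat_norm_scale by (simp add: field_simps del: funpow.simps)
qed

lemma fixing_iter_avg:
  assumes \<theta>: "fixing X \<theta>" and m: "m > 0"
  shows "fixing X (iter_avg m \<theta>)"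
  unfolding fixing_def
proof (intro conjI ballI allI)
  note lin = fixingD(1)[OF fixing_funpow[OF \<theta>]]
  show "linear (iter_avg m \<theta>)"
    by (rule linearI) (simp_all add: iter_avg_def linear_add[OF lin] linear_scale[OF lin] sum.distrib
        scaleR_add_right mult.commute flip: scaleR_sum_right del: funpow.simps)
  show "iter_avg m \<theta> x = x" if "x \<in> X" for x
    using m that by (simp add: iter_avg_def fixingD(2)[OF fixing_funpow[OF \<theta>]] sum_constant_scaleR del: funpow.simps)
  show "mat_norm n (\<lambda>i j. iter_avg m \<theta> (a i j)) \<le> mat_norm n a" for n a
    using mat_norm_iter_avg[OF assms, of n a] fixingD(3)[OF \<theta>, of n a] by linarith
qed

lemma iter_avg_diff:
  assumes \<theta>: "fixing X \<theta>"
  shows "norm (iter_avg m \<theta> (T - \<theta> T)) \<le> 2 * norm T / m"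
proof -
  have "(\<theta> ^^ Suc k) (T - \<theta> T) = (\<theta> ^^ Suc k) T - (\<theta> ^^ Suc (Suc k)) T" for k
    using linear_diff[OF fixingD(1)[OF fixing_funpow[OF \<theta>, of "Suc k"]]] by (simp add: funpow_swap1)
  then have "(\<Sum>k<m. (\<theta> ^^ Suc k) (T - \<theta> T)) = \<theta> T - (\<theta> ^^ Suc m) T"
    using sum_lessThan_telescope'[of "\<lambda>k. (\<theta> ^^ Suc k) T" m] by simp
  moreover have "norm (\<theta> T - (\<theta> ^^ Suc m) T) \<le> norm T + norm T"
    using fixing_norm[OF \<theta>, of T] fixing_norm[OF fixing_funpow[OF \<theta>], of "Suc m" T]
    by (intro order_trans[OF norm_triangle_ineq4] add_mono)
  ultimately show ?thesis by (simp add: iter_avg_def divide_right_mono)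
qed

text \<open>Let \<open>\<phi>\<close> be the map that belongs to a maximal ball \<open>K\<close>. By maximality, \<open>\<parallel>\<theta> a\<parallel> = \<parallel>\<phi> a\<parallel>\<close> for every map \<open>\<theta>\<close>
  with \<open>\<parallel>\<theta> a\<parallel> \<le> \<parallel>\<phi> a\<parallel>\<close>. This can be applied to the averages of the powers of such a \<open>\<theta>\<close>. They tend to zero
  on \<open>T - \<theta> T\<close>, so \<open>\<phi>\<close> vanishes there and \<open>\<phi> \<circ> \<theta> = \<phi>\<close>. The two
  equations are the cases \<open>\<theta> = \<phi>\<close> and \<open>\<theta> = \<psi> \<circ> \<phi>\<close>.\<close>
theorem minimal_fixing:
  fixes X :: "('h::chilbert_space \<Rightarrow>\<^sub>L 'h) set"
  assumes X: "subspace X"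
  shows "\<exists>\<phi>. fixing X \<phi> \<and> (\<forall>T. \<phi> (\<phi> T) = \<phi> T) \<and> (\<forall>\<psi> T. fixing X \<psi> \<longrightarrow> \<phi> (\<psi> (\<phi> T)) = \<phi> T)"
proof -
  obtain K where K: "matrix_ball X K" and max: "\<And>L. matrix_ball X L \<Longrightarrow> K \<subseteq> L \<Longrightarrow> L = K"
    using maximal_matrix_ball by blast
  obtain \<phi> where \<phi>: "fixing X \<phi>" and \<phi>K: "\<And>n a. (n, a) \<in> K \<Longrightarrow> mat_norm n (\<lambda>i j. \<phi> (a i j)) \<le> 1"
    using extension_fixing[OF K X] by blast
  have absorb: "\<phi> (\<theta> T) = \<phi> T"
    if \<theta>: "fixing X \<theta>" and dom: "\<And>n a. mat_norm n (\<lambda>i j. \<theta> (a i j)) \<le> mat_norm n (\<lambda>i j. \<phi> (a i j))" for \<theta> T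
  proof -
    define c where "c = 2 * norm T + 1"
    have c: "c > 0" by (simp add: c_def add_nonneg_pos)
    have le: "norm (\<phi> (T - \<theta> T)) \<le> c / real m" if m: "m > 0" for m
    proof -
      let ?L = "{(n, a). mat_norm n (\<lambda>i j. iter_avg m \<theta> (a i j)) \<le> 1}"
      have avg: "fixing X (iter_avg m \<theta>)" by (rule fixing_iter_avg[OF \<theta> m])
      have "K \<subseteq> ?L"
        using \<phi>K mat_norm_iter_avg[OF \<theta> m] dom order_trans by (fast intro: order_trans)
      then have "?L = K" using max matrix_ball_fixing[OF avg] by blast
      \<comment> \<open>The largest multiple of \<open>T - \<theta> T\<close> whose average is known to lie in the unit ball.\<close>
      let ?S = "(real m / c) *\<^sub>R (T - \<theta> T)"
      have "norm (iter_avg m \<theta> ?S) \<le> (m / c) * (2 * norm T / m)"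
        using c unfolding linear_scale[OF fixingD(1)[OF avg]] norm_scaleR
        by (intro mult_mono iter_avg_diff[OF \<theta>]) auto
      also have "\<dots> \<le> 1" using c m by (simp add: c_def)
      finally have "(1, \<lambda>i j. ?S) \<in> K"
        unfolding \<open>?L = K\<close>[symmetric] by (simp only: mem_Collect_eq split_conv mat_norm_one)
      then have "norm (\<phi> ?S) \<le> 1" using \<phi>K[of 1 "\<lambda>i j. ?S"] unfolding mat_norm_one by simp
      then show ?thesis using c m unfolding linear_scale[OF fixingD(1)[OF \<phi>]] by (simp add: field_simps)
    qed
    have "norm (\<phi> (T - \<theta> T)) \<le> 0"
    proof (rule LIMSEQ_le_const)
      show "(\<lambda>m. c / real m) \<longlonglongrightarrow> 0" by (rule lim_const_over_n)
      show "\<exists>N. \<forall>m\<ge>N. norm (\<phi> (T - \<theta> T)) \<le> c / real m" using le by (intro exI[of _ 1]) auto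
    qed
    then show ?thesis using linear_diff[OF fixingD(1)[OF \<phi>]] by simp
  qed
  have "\<phi> (\<psi> (\<phi> T)) = \<phi> T" if \<psi>: "fixing X \<psi>" for \<psi> T
    using absorb[OF fixing_comp[OF \<psi> \<phi>]] fixingD(3)[OF \<psi>] by simp
  then show ?thesis using \<phi> absorb[OF \<phi>] by blast
qed

section \<open>Multiplicativity\<close>

lemma mat_form_1: "mat_form 1 a \<xi> \<zeta> = inner (blinfun_apply (a 0 0) (\<xi> 0)) (\<zeta> 0)"
  by (simp add: mat_form_def)

lemma fixing_positive:
  assumes \<phi>: "fixing X \<phi>" and one: "id_blinfun \<in> X"
    and T: "\<And>h. 0 \<le> inner (blinfun_apply T h) h"
  shows "0 \<le> inner (blinfun_apply (\<phi> T) h) h"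
proof -
  have "accretive 1 (\<lambda>i j. T)" unfolding accretive_def mat_form_1 using T by simp
  from fixing_accretive[OF \<phi> one this] have "0 \<le> mat_form 1 (\<lambda>i j. \<phi> T) (\<lambda>_. h) (\<lambda>_. h)"
    unfolding accretive_def by blast
  then show ?thesis unfolding mat_form_1 .
qed

definition rigid :: "('h::chilbert_space \<Rightarrow>\<^sub>L 'h) set \<Rightarrow> (('h \<Rightarrow>\<^sub>L 'h) \<Rightarrow> ('h \<Rightarrow>\<^sub>L 'h)) \<Rightarrow> bool" where
  "rigid X \<phi> \<longleftrightarrow> fixing X \<phi> \<and> (\<forall>T. \<phi> (\<phi> T) = \<phi> T) \<and> (\<forall>\<psi> T. fixing X \<psi> \<longrightarrow> \<phi> (\<psi> (\<phi> T)) = \<phi> T)"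

lemma rigidD:
  assumes "rigid X \<phi>"
  shows "fixing X \<phi>" "\<phi> (\<phi> T) = \<phi> T" "fixing X \<psi> \<Longrightarrow> \<phi> (\<psi> (\<phi> T)) = \<phi> T"
  using assms unfolding rigid_def by blast+

text \<open>Two inequalities between positive operators: \<open>\<psi> (y\<^sup>* y) \<ge> y\<^sup>* y\<close>, to which \<open>\<phi>\<close> is applied, and
  \<open>\<phi> (y\<^sup>* y) \<ge> y\<^sup>* y\<close>, to which \<open>\<phi> \<circ> \<psi>\<close> is applied; the left-hand side of the latter becomes
  \<open>\<phi> (\<psi> (\<phi> (y\<^sup>* y))) = \<phi> (y\<^sup>* y)\<close>.\<close>
lemma rigid_square:
  assumes \<phi>: "rigid X \<phi>" and one: "id_blinfun \<in> X" and \<psi>: "fixing X \<psi>"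
    and y: "\<forall>\<theta>. fixing X \<theta> \<longrightarrow> \<theta> y = y"
  shows "inner (blinfun_apply (\<phi> (\<psi> (adj y o\<^sub>L y))) h) h = inner (blinfun_apply (\<phi> (adj y o\<^sub>L y)) h) h"
proof -
  let ?q = "adj y o\<^sub>L y"
  note \<phi>f = rigidD(1)[OF \<phi>]
  note lin = fixingD(1)[OF \<phi>f] and lin\<psi> = fixingD(1)[OF \<psi>]
  have ks: "0 \<le> inner (blinfun_apply (\<theta> ?q - ?q) k) k" if \<theta>: "fixing X \<theta>" for \<theta> k
  proof -
    have "0 \<le> mat_form 1 (\<lambda>i j. \<theta> ?q - (adj (\<theta> y) o\<^sub>L \<theta> y)) (\<lambda>_. k) (\<lambda>_. k)"
      using kadison_schwarz[OF \<theta> one, of 1 "\<lambda>_. y"] unfolding accretive_def by blast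
    then show ?thesis unfolding y[rule_format, OF \<theta>] mat_form_1 .
  qed
  have "0 \<le> inner (blinfun_apply (\<phi> (\<psi> ?q - ?q)) h) h"
    by (intro fixing_positive[OF \<phi>f one] ks[OF \<psi>])
  moreover have "0 \<le> inner (blinfun_apply ((\<phi> \<circ> \<psi>) (\<phi> ?q - ?q)) h) h"
    by (intro fixing_positive[OF fixing_comp[OF \<phi>f \<psi>] one] ks[OF \<phi>f])
  ultimately show ?thesis
    by (simp add: linear_diff[OF lin] linear_diff[OF lin\<psi>] rigidD(3)[OF \<phi> \<psi>] blinfun.bilinear_simps inner_diff_left)
qed

text \<open>Apply \<open>\<phi>\<close> to the Kadison--Schwarz inequality for \<open>\<psi>\<close> and the pair \<open>y\<close>, \<open>b\<close>. The resulting accretive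
  two-by-two matrix has a vanishing quadratic form in its upper left corner by \<open>rigid_square\<close>, so its off-diagonal
  entries vanish.\<close>
lemma rigid_module:
  assumes \<phi>: "rigid X \<phi>" and one: "id_blinfun \<in> X" and \<psi>: "fixing X \<psi>"
    and y: "\<forall>\<theta>. fixing X \<theta> \<longrightarrow> \<theta> y = y"
  shows "\<phi> (\<psi> (adj y o\<^sub>L b)) = \<phi> (adj y o\<^sub>L \<psi> b)"
proof -
  note \<phi>f = rigidD(1)[OF \<phi>]
  note lin = fixingD(1)[OF \<phi>f] and lin\<psi> = fixingD(1)[OF \<psi>]
  define d where "d i = (if i = (0::nat) then y else b)" for i
  define D where "D i j = \<phi> (\<psi> (adj (d i) o\<^sub>L d j) - (adj (\<psi> (d i)) o\<^sub>L \<psi> (d j)))" for i j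
  have acc: "accretive 2 D"
    unfolding D_def by (intro fixing_accretive[OF \<phi>f one] kadison_schwarz[OF \<psi> one])
  have D00: "inner (blinfun_apply (D 0 0) h) h = 0" for h
    unfolding D_def d_def using rigid_square[OF \<phi> one \<psi> y, of h] y[rule_format, OF \<psi>]
    by (simp add: linear_diff[OF lin] blinfun.bilinear_simps inner_diff_left)
  have D10: "D 1 0 = adj (D 0 1)"
    unfolding D_def by (simp add: fixing_adj[OF \<phi>f one, symmetric] fixing_adj[OF \<psi> one, symmetric] adj_simps)
  have zero: "inner (blinfun_apply (D 0 1) k) h = 0" for h k
  proof -
    let ?p = "inner (blinfun_apply (D 0 1) k) h" and ?r = "inner (blinfun_apply (D 1 1) k) k"
    have q: "0 \<le> 2 * t * ?p + ?r" for t
    proof -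
      have "0 \<le> mat_form 2 D (\<lambda>i. if i = 0 then t *\<^sub>R h else k) (\<lambda>i. if i = 0 then t *\<^sub>R h else k)"
        using acc unfolding accretive_def by blast
      then show ?thesis
        unfolding mat_form_2 D10
        by (simp add: D00 inner_adj blinfun.bilinear_simps) (simp add: inner_commute)
    qed
    \<comment> \<open>An affine function of \<open>t\<close> that is bounded below is constant.\<close>
    show ?thesis
    proof (rule ccontr)
      assume "?p \<noteq> 0"
      then have "2 * (- (?r + 1) / (2 * ?p)) * ?p = - (?r + 1)" by simp
      then show False using q[of "- (?r + 1) / (2 * ?p)"] by linarith
    qed
  qed
  have "D 0 1 = 0" by (rule blinfun_eq_by_inner) (simp only: zero blinfun.zero_left inner_zero_left)
  then show ?thesis unfolding D_def d_def by (simp add: linear_diff[OF lin] y[rule_format, OF \<psi>])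
qed

text \<open>A one-sided multiplicative domain, for all maps \<open>\<phi> \<circ> \<psi>\<close> at once. The choice \<open>b = 1\<close>
  gives \<open>\<phi> (\<psi> c) = \<phi> c\<close>, and \<open>\<psi> = \<phi>\<close> gives \<open>\<phi> (c b) = \<phi> (c \<phi> b)\<close> when \<open>\<phi>\<close> is idempotent.\<close>
definition mult_domain :: "('h::chilbert_space \<Rightarrow>\<^sub>L 'h) set \<Rightarrow> (('h \<Rightarrow>\<^sub>L 'h) \<Rightarrow> ('h \<Rightarrow>\<^sub>L 'h)) \<Rightarrow> ('h \<Rightarrow>\<^sub>L 'h) set" where
  "mult_domain X \<phi> = {c. \<forall>\<psi> b. fixing X \<psi> \<longrightarrow> \<phi> (\<psi> (c o\<^sub>L b)) = \<phi> (c o\<^sub>L \<psi> b)}"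

lemma mult_domain_contains:
  assumes \<phi>: "rigid X \<phi>" and one: "id_blinfun \<in> X" and x: "x \<in> X"
  shows "x \<in> mult_domain X \<phi>" "adj x \<in> mult_domain X \<phi>"
proof -
  have x_fix: "\<forall>\<theta>. fixing X \<theta> \<longrightarrow> \<theta> x = x" using fixingD(2)[OF _ x] by blast
  have adj_fix: "\<forall>\<theta>. fixing X \<theta> \<longrightarrow> \<theta> (adj x) = adj x"
    using fixing_adj[OF _ one] fixingD(2)[OF _ x] by metis
  show "adj x \<in> mult_domain X \<phi>"
    unfolding mult_domain_def using rigid_module[OF \<phi> one _ x_fix] by blast
  show "x \<in> mult_domain X \<phi>"
    unfolding mult_domain_def using rigid_module[OF \<phi> one _ adj_fix] by (simp add: adj_simps)
qed

text \<open>The factor \<open>c\<close> is pulled out for \<open>\<psi>\<close>; then \<open>\<phi>\<close> is inserted behind \<open>c\<close>, which allows \<open>d\<close> to be pulled out, and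
  is removed again.\<close>
lemma mult_domain_mult:
  assumes \<phi>: "rigid X \<phi>" and c: "c \<in> mult_domain X \<phi>" and d: "d \<in> mult_domain X \<phi>"
  shows "c o\<^sub>L d \<in> mult_domain X \<phi>"
  unfolding mult_domain_def
proof (intro CollectI allI impI)
  fix \<psi> b assume \<psi>: "fixing X \<psi>"
  have C: "\<phi> (\<theta> (c o\<^sub>L e)) = \<phi> (c o\<^sub>L \<theta> e)" if "fixing X \<theta>" for \<theta> e
    using c that unfolding mult_domain_def by blast
  have D: "\<phi> (\<psi> (d o\<^sub>L b)) = \<phi> (d o\<^sub>L \<psi> b)" using d \<psi> unfolding mult_domain_def by blast
  have absorb: "\<phi> (c o\<^sub>L \<phi> e) = \<phi> (c o\<^sub>L e)" for e
    using C[OF rigidD(1)[OF \<phi>], of e] by (simp add: rigidD(2)[OF \<phi>])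
  have assoc: "(S o\<^sub>L T) o\<^sub>L U = S o\<^sub>L (T o\<^sub>L U)" for S T U :: "'a \<Rightarrow>\<^sub>L 'a"
    by (rule blinfun_eqI) simp
  have "\<phi> (\<psi> ((c o\<^sub>L d) o\<^sub>L b)) = \<phi> (c o\<^sub>L \<psi> (d o\<^sub>L b))" unfolding assoc by (rule C[OF \<psi>])
  also have "\<dots> = \<phi> (c o\<^sub>L \<phi> (\<psi> (d o\<^sub>L b)))" by (simp only: absorb)
  also have "\<dots> = \<phi> (c o\<^sub>L \<phi> (d o\<^sub>L \<psi> b))" by (simp only: D)
  also have "\<dots> = \<phi> ((c o\<^sub>L d) o\<^sub>L \<psi> b)" by (simp only: absorb assoc)
  finally show "\<phi> (\<psi> ((c o\<^sub>L d) o\<^sub>L b)) = \<phi> ((c o\<^sub>L d) o\<^sub>L \<psi> b)" .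
qed

lemma mult_domain_add:
  assumes \<phi>: "rigid X \<phi>" and "c \<in> mult_domain X \<phi>" "d \<in> mult_domain X \<phi>"
  shows "c + d \<in> mult_domain X \<phi>"
proof -
  have "\<phi> (\<psi> ((c + d) o\<^sub>L b)) = \<phi> ((c + d) o\<^sub>L \<psi> b)" if \<psi>: "fixing X \<psi>" for \<psi> b
    using assms(2,3) \<psi> unfolding mult_domain_def
    by (simp add: bounded_bilinear.add_left[OF bounded_bilinear_blinfun_compose] linear_add[OF fixingD(1)[OF \<psi>]]
        linear_add[OF fixingD(1)[OF rigidD(1)[OF \<phi>]]])
  then show ?thesis unfolding mult_domain_def by blast
qed

lemma closed_mult_domain:
  assumes \<phi>: "rigid X \<phi>"
  shows "closed (mult_domain X \<phi>)"
proof -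
  note bl = fixing_bounded_linear[OF rigidD(1)[OF \<phi>]]
  have cl: "closed {c. \<phi> (\<psi> (c o\<^sub>L b)) = \<phi> (c o\<^sub>L \<psi> b)}" if \<psi>: "fixing X \<psi>" for \<psi> b
    by (intro closed_Collect_eq bounded_linear.continuous_on[OF bl]
        bounded_linear.continuous_on[OF fixing_bounded_linear[OF \<psi>]]
        bounded_linear.continuous_on[OF bounded_bilinear.bounded_linear_left[OF bounded_bilinear_blinfun_compose]] continuous_on_id)
  have "mult_domain X \<phi> = (\<Inter>\<psi>\<in>{\<psi>. fixing X \<psi>}. \<Inter>b. {c. \<phi> (\<psi> (c o\<^sub>L b)) = \<phi> (c o\<^sub>L \<psi> b)})"
    unfolding mult_domain_def by blast
  then show ?thesis using cl by (auto intro!: closed_INT)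
qed

section \<open>The generated algebra\<close>

lemma bounded_opsD: "A \<in> bounded_ops \<Longrightarrow> blinfun_apply A (c *\<^sub>C x) = c *\<^sub>C blinfun_apply A x"
  unfolding bounded_ops_def by blast

lemma cinner_eq_inner: "cinner x y = Complex (inner x y) (inner x (\<i> *\<^sub>C y))"
  by (simp add: inner_eq_Re_cinner cinner_scaleC_right complex_eq_iff)

lemma scaleC_left_inner: "inner (c *\<^sub>C x) y = inner (x :: 'a::complex_inner) (cnj c *\<^sub>C y)"
  by (simp add: inner_eq_Re_cinner cinner_scaleC_right cinner_scaleC_left)

lemma adj_bounded_ops:
  assumes A: "A \<in> bounded_ops"
  shows "adj A \<in> bounded_ops"
proof -
  have "blinfun_apply (adj A) (c *\<^sub>C x) = c *\<^sub>C blinfun_apply (adj A) x" for c x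
  proof (rule vector_eq_rdot[THEN iffD1], rule allI)
    fix y
    show "inner (blinfun_apply (adj A) (c *\<^sub>C x)) y = inner (c *\<^sub>C blinfun_apply (adj A) x) y"
      by (simp add: inner_adj scaleC_left_inner bounded_opsD[OF A])
  qed
  then show ?thesis unfolding bounded_ops_def by blast
qed

lemma hadjoint_eq_adj:
  assumes A: "A \<in> bounded_ops"
  shows "hadjoint A = adj A"
proof (rule hadjoint_eqI)
  fix x y
  show "cinner (blinfun_apply A x) y = cinner x (blinfun_apply (adj A) y)"
    by (simp add: cinner_eq_inner inner_adj_right bounded_opsD[OF adj_bounded_ops[OF A], symmetric])
qed

lemma scaleC_blinfun_apply: "blinfun_apply (c *\<^sub>C A) x = c *\<^sub>C blinfun_apply A x"
  by transfer simp

lemma csubspace_subspace: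
  assumes "csubspace V"
  shows "subspace V"
  using assms unfolding csubspace_def subspace_def by (metis scaleC_of_real)

lemma csubspace_0: "csubspace V \<Longrightarrow> 0 \<in> V"
  unfolding csubspace_def by blast

lemma scaleC_conv_compose: "c *\<^sub>C A = (c *\<^sub>C id_blinfun) o\<^sub>L A"
  by (rule blinfun_eqI) (simp add: scaleC_blinfun_apply)

lemma bounded_ops_closed: "closed (bounded_ops :: ('a::chilbert_space \<Rightarrow>\<^sub>L 'a) set)"
proof -
  have cl: "closed {A :: 'a \<Rightarrow>\<^sub>L 'a. blinfun_apply A (c *\<^sub>C x) = c *\<^sub>C blinfun_apply A x}" for c and x :: 'a
    by (intro closed_Collect_eq linear_continuous_on blinfun.bounded_linear_left
        bounded_linear_compose[OF bounded_linear_scaleC blinfun.bounded_linear_left])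
  have eq: "bounded_ops = (\<Inter>c. \<Inter>x. {A :: 'a \<Rightarrow>\<^sub>L 'a. blinfun_apply A (c *\<^sub>C x) = c *\<^sub>C blinfun_apply A x})"
    unfolding bounded_ops_def by blast
  show ?thesis unfolding eq by (intro closed_INT ballI cl)
qed

lemma scaleC_zero: "c *\<^sub>C (0::'a::complex_vector) = 0"
  using scaleC_add_right[of c 0 0] by simp

lemma bounded_ops_algebra:
  "0 \<in> bounded_ops"
  "A \<in> bounded_ops \<Longrightarrow> B \<in> bounded_ops \<Longrightarrow> A + B \<in> bounded_ops"
  "A \<in> bounded_ops \<Longrightarrow> c *\<^sub>C A \<in> bounded_ops"
  "A \<in> bounded_ops \<Longrightarrow> B \<in> bounded_ops \<Longrightarrow> A o\<^sub>L B \<in> bounded_ops"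
  unfolding bounded_ops_def
  by (simp_all add: blinfun.bilinear_simps scaleC_zero scaleC_add_right scaleC_blinfun_apply scaleC_scaleC mult.commute)

lemma cstar_subalgebra_bounded_ops: "cstar_subalgebra bounded_ops"
  unfolding cstar_subalgebra_def csubspace_def selfadjoint_set_def
  by (auto simp: bounded_ops_algebra bounded_ops_closed hadjoint_eq_adj adj_bounded_ops)

lemma cstar_generated_props:
  assumes X: "X \<subseteq> bounded_ops"
  shows "cstar_subalgebra (cstar_generated X)" "X \<subseteq> cstar_generated X"
proof -
  let ?F = "{A. cstar_subalgebra A \<and> X \<subseteq> A}"
  have b: "bounded_ops \<in> ?F" using X cstar_subalgebra_bounded_ops by blast
  have "closed (\<Inter>?F)" by (rule closed_Inter) (simp add: cstar_subalgebra_def)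
  moreover have "\<Inter>?F \<subseteq> bounded_ops" using b by blast
  moreover have "csubspace (\<Inter>?F)" unfolding csubspace_def cstar_subalgebra_def by blast
  moreover have "selfadjoint_set (\<Inter>?F)" unfolding selfadjoint_set_def cstar_subalgebra_def by blast
  moreover have "\<forall>S\<in>\<Inter>?F. \<forall>T\<in>\<Inter>?F. S o\<^sub>L T \<in> \<Inter>?F" unfolding cstar_subalgebra_def by blast
  ultimately show "cstar_subalgebra (cstar_generated X)"
    unfolding cstar_generated_def unfolding cstar_subalgebra_def by blast
  show "X \<subseteq> cstar_generated X" unfolding cstar_generated_def by blast
qed

text \<open>The elements of the multiplicative domain whose adjoints also belong to it form a
  C*-algebra that contains \<open>X\<close>. Closure under complex scalars follows from closure under products.\<close>
lemma cstar_generated_mult_domain: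
  assumes X: "unital_operator_space X" and \<phi>: "rigid X \<phi>"
  shows "cstar_generated X \<subseteq> mult_domain X \<phi>"
proof -
  have Xs: "X \<subseteq> bounded_ops" "csubspace X" "id_blinfun \<in> X" using X unfolding unital_operator_space_def by auto
  define M where "M = {c \<in> bounded_ops. c \<in> mult_domain X \<phi> \<and> adj c \<in> mult_domain X \<phi>}"
  have "X \<subseteq> M" unfolding M_def using Xs mult_domain_contains[OF \<phi> Xs(3)] by blast
  have zero: "0 \<in> M" using \<open>X \<subseteq> M\<close> csubspace_0[OF Xs(2)] by blast
  have mult: "S o\<^sub>L T \<in> M" if "S \<in> M" "T \<in> M" for S T
    using that unfolding M_def by (auto simp: adj_simps bounded_ops_algebra intro: mult_domain_mult[OF \<phi>])
  have add: "S + T \<in> M" if "S \<in> M" "T \<in> M" for S T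
    using that unfolding M_def by (auto simp: adj_simps bounded_ops_algebra intro: mult_domain_add[OF \<phi>])
  have "c *\<^sub>C T \<in> M" if "T \<in> M" for c T
  proof -
    have "c *\<^sub>C id_blinfun \<in> M" using \<open>X \<subseteq> M\<close> Xs(2,3) unfolding csubspace_def by blast
    then show ?thesis using mult that by (subst scaleC_conv_compose) blast
  qed
  then have "csubspace M" using zero add unfolding csubspace_def by blast
  moreover have "selfadjoint_set M"
    unfolding selfadjoint_set_def M_def by (auto simp: hadjoint_eq_adj adj_bounded_ops adj_simps)
  moreover have "closed M"
  proof -
    have "closed (adj -` mult_domain X \<phi>)"
      by (intro closed_vimage closed_mult_domain[OF \<phi>] bounded_linear.continuous_on[OF bounded_linear_adj] continuous_on_id)
    moreover have "M = bounded_ops \<inter> (mult_domain X \<phi> \<inter> adj -` mult_domain X \<phi>)" unfolding M_def by blast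
    ultimately show ?thesis by (simp add: closed_Int bounded_ops_closed closed_mult_domain[OF \<phi>])
  qed
  moreover have "M \<subseteq> bounded_ops" unfolding M_def by blast
  ultimately have "cstar_subalgebra M" using mult unfolding cstar_subalgebra_def by blast
  then have "cstar_generated X \<subseteq> M" using \<open>X \<subseteq> M\<close> unfolding cstar_generated_def by blast
  then show ?thesis unfolding M_def by blast
qed

section \<open>Boundary subsystems\<close>

lemma quot_mat_norm_alt:
  "quot_mat_norm n (\<lambda>i j. quot_map V (a i j)) = (INF b\<in>{b. \<forall>i<n. \<forall>j<n. b i j - a i j \<in> V}. mat_norm n b)"
proof -
  have "b \<in> quot_map V c \<longleftrightarrow> b - c \<in> V" for b c
    unfolding quot_map_def by (auto intro!: exI[of _ "b - c"])
  then show ?thesis unfolding quot_mat_norm_def by simp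
qed

lemma bdd_below_mat_norm: "bdd_below (mat_norm n ` B)"
  by (rule bdd_belowI2[of _ 0]) (rule mat_norm_nonneg)

text \<open>The quotient norm never exceeds the norm, so only the lower bound for all representatives is at stake.\<close>
lemma completely_isometric_quot_iff:
  assumes "0 \<in> V"
  shows "completely_isometric_on X mat_norm quot_mat_norm (quot_map V) \<longleftrightarrow>
    (\<forall>n a b. (\<forall>i<n. \<forall>j<n. a i j \<in> X \<and> b i j - a i j \<in> V) \<longrightarrow> mat_norm n a \<le> mat_norm n b)"
    (is "?L \<longleftrightarrow> ?R")
proof
  assume L: ?L
  show ?R
  proof (intro allI impI)
    fix n and a b :: "nat \<Rightarrow> nat \<Rightarrow> ('a \<Rightarrow>\<^sub>L 'a)"
    assume ab: "\<forall>i<n. \<forall>j<n. a i j \<in> X \<and> b i j - a i j \<in> V"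
    then have "mat_norm n a = quot_mat_norm n (\<lambda>i j. quot_map V (a i j))"
      using L unfolding completely_isometric_on_def by simp
    also have "\<dots> \<le> mat_norm n b"
      unfolding quot_mat_norm_alt using ab by (intro cINF_lower bdd_below_mat_norm) auto
    finally show "mat_norm n a \<le> mat_norm n b" .
  qed
next
  assume R: ?R
  show ?L
    unfolding completely_isometric_on_def
  proof (intro allI impI)
    fix n and a :: "nat \<Rightarrow> nat \<Rightarrow> ('a \<Rightarrow>\<^sub>L 'a)"
    assume a: "\<forall>i<n. \<forall>j<n. a i j \<in> X"
    show "quot_mat_norm n (\<lambda>i j. quot_map V (a i j)) = mat_norm n a"
      unfolding quot_mat_norm_alt
    proof (rule antisym)
      show "(INF b\<in>{b. \<forall>i<n. \<forall>j<n. b i j - a i j \<in> V}. mat_norm n b) \<le> mat_norm n a"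
        using assms by (intro cINF_lower bdd_below_mat_norm) simp
      have "mat_norm n a \<le> mat_norm n b" if "\<forall>i<n. \<forall>j<n. b i j - a i j \<in> V" for b
        using R a that by blast
      then show "mat_norm n a \<le> (INF b\<in>{b. \<forall>i<n. \<forall>j<n. b i j - a i j \<in> V}. mat_norm n b)"
        using assms by (intro cINF_greatest) (auto intro!: exI[of _ a])
    qed
  qed
qed

text \<open>The matrices with a representative of norm at most \<open>1\<close> modulo \<open>V\<close>. They lie between the open and
  the closed unit ball of the quotient seminorm.\<close>
lemma matrix_ball_quotient:
  assumes V: "subspace V" and iso: "completely_isometric_on X mat_norm quot_mat_norm (quot_map V)"
  shows "matrix_ball X {(n, a). \<exists>b. (\<forall>i j. b i j - a i j \<in> V) \<and> mat_norm n b \<le> 1}"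
  unfolding matrix_ball_def
proof (intro conjI allI impI; unfold mem_Collect_eq split_conv)
  note V0 = subspace_0[OF V]
  show "\<exists>b. (\<forall>i j. b i j - a i j \<in> V) \<and> mat_norm n b \<le> 1" if "mat_norm n a \<le> 1" for n a
    using that V0 by (intro exI[of _ a]) simp
  show "\<exists>b. (\<forall>i j. b i j - compress n P Q a i j \<in> V) \<and> mat_norm n b \<le> 1"
    if ex: "\<exists>b. (\<forall>i j. b i j - a i j \<in> V) \<and> mat_norm n b \<le> 1" and PQ: "coeff_proj n P" "coeff_proj n Q" for n a P Q
  proof -
    obtain b where b: "\<And>i j. b i j - a i j \<in> V" "mat_norm n b \<le> 1" using ex by blast
    have "compress n P Q b i j - compress n P Q a i j = compress n P Q (\<lambda>i j. b i j - a i j) i j" for i j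
      by (simp add: compress_def sum_subtractf scaleR_diff_right)
    moreover have "compress n P Q (\<lambda>i j. b i j - a i j) i j \<in> V" for i j
      unfolding compress_def by (intro subspace_sum V subspace_scale b)
    ultimately show ?thesis using mat_norm_compress[OF PQ b(2)] by (intro exI[of _ "compress n P Q b"]) simp
  qed
  show "\<exists>d. (\<forall>i j. d i j - block_diag m a a' i j \<in> V) \<and> mat_norm (m + n) d \<le> 1"
    if ex: "\<exists>b. (\<forall>i j. b i j - a i j \<in> V) \<and> mat_norm m b \<le> 1"
      "\<exists>b. (\<forall>i j. b i j - a' i j \<in> V) \<and> mat_norm n b \<le> 1" for m a n a'
  proof -
    obtain b where b: "\<And>i j. b i j - a i j \<in> V" "mat_norm m b \<le> 1" using ex by blast
    obtain b' where b': "\<And>i j. b' i j - a' i j \<in> V" "mat_norm n b' \<le> 1" using ex by blast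
    show ?thesis using mat_norm_block_diag[OF b(2) b'(2)] b(1) b'(1) V0
      by (intro exI[of _ "block_diag m b b'"]) (simp add: block_diag_def)
  qed
  show "mat_norm n a \<le> 1"
    if ex: "\<exists>b. (\<forall>i j. b i j - a i j \<in> V) \<and> mat_norm n b \<le> 1" and a: "\<forall>i<n. \<forall>j<n. a i j \<in> X" for n a
  proof -
    obtain b where b: "\<And>i j. b i j - a i j \<in> V" "mat_norm n b \<le> 1" using ex by blast
    have "mat_norm n a \<le> mat_norm n b" using iso a b(1) unfolding completely_isometric_quot_iff[OF V0] by blast
    then show ?thesis using b(2) by linarith
  qed
qed

lemma fixing_vanishing_on:
  assumes X: "subspace X" and V: "subspace V"
    and iso: "completely_isometric_on X mat_norm quot_mat_norm (quot_map V)"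
  shows "\<exists>\<psi>. fixing X \<psi> \<and> (\<forall>v\<in>V. \<psi> v = 0)"
proof -
  obtain \<psi> where \<psi>: "fixing X \<psi>"
    and le: "\<And>n a. (n, a) \<in> {(n, a). \<exists>b. (\<forall>i j. b i j - a i j \<in> V) \<and> mat_norm n b \<le> 1} \<Longrightarrow>
      mat_norm n (\<lambda>i j. \<psi> (a i j)) \<le> 1"
    using extension_fixing[OF matrix_ball_quotient[OF V iso] X] by blast
  have "\<psi> v = 0" if v: "v \<in> V" for v
  proof -
    \<comment> \<open>Every multiple of \<open>v\<close> is represented by \<open>0\<close> modulo \<open>V\<close>.\<close>
    have *: "norm (\<psi> (r *\<^sub>R v)) \<le> 1" for r
    proof -
      have "mat_norm 1 (\<lambda>i j. 0 :: 'a \<Rightarrow>\<^sub>L 'a) \<le> 1" unfolding mat_norm_one by simp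
      moreover have "0 - r *\<^sub>R v \<in> V" using V v by (simp add: subspace_neg subspace_scale)
      ultimately show ?thesis
        unfolding mat_norm_one[symmetric] by (intro le CollectI case_prodI exI[of _ "\<lambda>i j. 0"]) simp
    qed
    show ?thesis
    proof (rule ccontr)
      assume "\<psi> v \<noteq> 0"
      then show False using *[of "2 / norm (\<psi> v)"] by (simp add: linear_scale[OF fixingD(1)[OF \<psi>]])
    qed
  qed
  then show ?thesis using \<psi> by blast
qed

text \<open>The ideal is the kernel on \<open>C\<close> of the minimal map \<open>\<phi>\<close>. Boundary subspaces lie in it because some \<open>\<psi>\<close> kills
  them and \<open>\<phi> \<circ> \<psi> = \<phi>\<close> on \<open>C\<close>.\<close>
theorem biggest_boundary_ideal_exists:
  fixes X :: "('h::chilbert_space \<Rightarrow>\<^sub>L 'h) set"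
  assumes X: "unital_operator_space X"
  shows "\<exists>J. boundary_ideal X (cstar_generated X) J \<and> selfadjoint_set J \<and>
    (\<forall>V. V \<subseteq> cstar_generated X \<longrightarrow> csubspace V \<longrightarrow>
      completely_isometric_on X mat_norm quot_mat_norm (quot_map V) \<longrightarrow> V \<subseteq> J)"
proof -
  have Xs: "X \<subseteq> bounded_ops" "csubspace X" "id_blinfun \<in> X" using X unfolding unital_operator_space_def by auto
  define C where "C = cstar_generated X"
  have C: "cstar_subalgebra C" "X \<subseteq> C" unfolding C_def using cstar_generated_props[OF Xs(1)] by auto
  then have Cs: "C \<subseteq> bounded_ops" "csubspace C" "selfadjoint_set C" "closed C"
    and Cmult: "\<And>S T. S \<in> C \<Longrightarrow> T \<in> C \<Longrightarrow> S o\<^sub>L T \<in> C" unfolding cstar_subalgebra_def by auto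
  have Cadj: "adj c \<in> C" if "c \<in> C" for c
  proof -
    have "hadjoint c \<in> C" using that Cs(3) unfolding selfadjoint_set_def by blast
    moreover have "c \<in> bounded_ops" using that Cs(1) by blast
    ultimately show ?thesis by (simp add: hadjoint_eq_adj)
  qed
  obtain \<phi> where \<phi>: "rigid X \<phi>"
    using minimal_fixing[OF csubspace_subspace[OF Xs(2)]] unfolding rigid_def by blast
  note \<phi>f = rigidD(1)[OF \<phi>]
  note lin = fixingD(1)[OF \<phi>f]
  have mod: "\<phi> (\<psi> (c o\<^sub>L b)) = \<phi> (c o\<^sub>L \<psi> b)" if "c \<in> C" "fixing X \<psi>" for c \<psi> b
    using cstar_generated_mult_domain[OF X \<phi>] that unfolding C_def mult_domain_def by blast
  have adj: "\<phi> (adj T) = adj (\<phi> T)" for T by (rule fixing_adj[OF \<phi>f Xs(3)])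
  have unique: "\<phi> (\<psi> c) = \<phi> c" if "c \<in> C" "fixing X \<psi>" for c \<psi>
  proof -
    have "c o\<^sub>L id_blinfun = c" by (rule blinfun_eqI) simp
    then show ?thesis using mod[OF that, of id_blinfun] fixingD(2)[OF that(2) Xs(3)] by simp
  qed
  define J where "J = {c \<in> C. \<phi> c = 0}"
  have J_adj: "adj c \<in> J" if "c \<in> J" for c
    using that Cadj unfolding J_def by (simp add: adj adj_simps)
  \<comment> \<open>The ideal properties hold since \<open>\<phi> (S T) = \<phi> (S \<phi> T)\<close>.\<close>
  have J_left: "S o\<^sub>L T \<in> J" if "S \<in> C" "T \<in> J" for S T
    using that Cmult mod[OF that(1) \<phi>f, of T] unfolding J_def
    by (simp add: rigidD(2)[OF \<phi>] bounded_bilinear.zero_right[OF bounded_bilinear_blinfun_compose] linear_0[OF lin])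
  have J_right: "T o\<^sub>L S \<in> J" if "S \<in> C" "T \<in> J" for S T
    using J_adj[OF J_left[OF Cadj[OF that(1)] J_adj[OF that(2)]]] by (simp add: adj_simps)
  have scalar: "c *\<^sub>C id_blinfun \<in> C" for c using Xs C(2) unfolding csubspace_def by blast
  have "csubspace J"
    unfolding csubspace_def
  proof (intro conjI ballI allI)
    show "0 \<in> J" unfolding J_def using csubspace_0[OF Cs(2)] by (simp add: linear_0[OF lin])
    show "x + y \<in> J" if "x \<in> J" "y \<in> J" for x y
      using that Cs(2) unfolding J_def csubspace_def by (simp add: linear_add[OF lin])
    show "c *\<^sub>C x \<in> J" if "x \<in> J" for c x
      by (subst scaleC_conv_compose) (rule J_left[OF scalar that])
  qed
  moreover have "closed J"
  proof -
    have "closed {c. \<phi> c = 0}"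
      by (intro closed_Collect_eq bounded_linear.continuous_on[OF fixing_bounded_linear[OF \<phi>f]] continuous_on_id continuous_on_const)
    moreover have "J = C \<inter> {c. \<phi> c = 0}" unfolding J_def by blast
    ultimately show ?thesis using Cs(4) by (simp add: closed_Int)
  qed
  ultimately have "closed_ideal C J"
    unfolding closed_ideal_def using J_left J_right unfolding J_def by blast
  moreover have "completely_isometric_on X mat_norm quot_mat_norm (quot_map J)"
    unfolding completely_isometric_quot_iff[OF csubspace_0[OF \<open>csubspace J\<close>]]
  proof (intro allI impI)
    fix n and a b :: "nat \<Rightarrow> nat \<Rightarrow> ('h \<Rightarrow>\<^sub>L 'h)"
    assume ab: "\<forall>i<n. \<forall>j<n. a i j \<in> X \<and> b i j - a i j \<in> J"
    have "mat_norm n a = mat_norm n (\<lambda>i j. \<phi> (b i j))"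
    proof (rule mat_norm_cong)
      fix i j assume "i < n" "j < n"
      then have "a i j \<in> X" "\<phi> (b i j - a i j) = 0" using ab unfolding J_def by auto
      then show "a i j = \<phi> (b i j)" using fixingD(2)[OF \<phi>f] by (simp add: linear_diff[OF lin])
    qed
    also have "\<dots> \<le> mat_norm n b" by (rule fixingD(3)[OF \<phi>f])
    finally show "mat_norm n a \<le> mat_norm n b" .
  qed
  moreover have "selfadjoint_set J"
    unfolding selfadjoint_set_def
  proof
    fix c assume "c \<in> J"
    moreover from this have "c \<in> bounded_ops" using Cs(1) unfolding J_def by blast
    ultimately show "hadjoint c \<in> J" using J_adj by (simp add: hadjoint_eq_adj)
  qed
  moreover have "V \<subseteq> J" if V: "V \<subseteq> C" "csubspace V" "completely_isometric_on X mat_norm quot_mat_norm (quot_map V)" for V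
  proof
    fix v assume v: "v \<in> V"
    obtain \<psi> where \<psi>: "fixing X \<psi>" "\<forall>v\<in>V. \<psi> v = 0"
      using fixing_vanishing_on[OF csubspace_subspace[OF Xs(2)] csubspace_subspace[OF V(2)] V(3)] by blast
    have "\<phi> v = \<phi> (\<psi> v)" using unique[OF _ \<psi>(1)] v V(1) by auto
    then show "v \<in> J" unfolding J_def using v V(1) \<psi>(2) by (auto simp: linear_0[OF lin])
  qed
  ultimately show ?thesis unfolding boundary_ideal_def C_def by blast
qed

theorem corollary3p3:
  fixes X C :: "('h::chilbert_space \<Rightarrow>\<^sub>L 'h) set"
  assumes "unital_operator_space X"
    and "C = cstar_generated X"
  shows "boundary_subsystem X C (silov_ideal X C) \<and>
    (\<forall>V. boundary_subsystem X C V \<longrightarrow> V \<subseteq> silov_ideal X C)"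
proof -
  obtain J where J: "boundary_ideal X C J" "selfadjoint_set J"
    and biggest: "\<And>V. V \<subseteq> C \<Longrightarrow> csubspace V \<Longrightarrow>
      completely_isometric_on X mat_norm quot_mat_norm (quot_map V) \<Longrightarrow> V \<subseteq> J"
    using biggest_boundary_ideal_exists[OF assms(1)] unfolding assms(2) by blast
  have "silov_ideal X C = J"
    using J(1) biggest by (intro silov_ideal_eqI) (auto simp: boundary_ideal_def closed_ideal_def)
  then show ?thesis
    using J biggest unfolding boundary_subsystem_def boundary_ideal_def closed_ideal_def by auto
qed

end
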